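(* Let $X$ be an $\mathcal{SL}$-submartingale, and let $S\le T$ be bounded stopping times. Then $X_S\le\mathcal{E}_S(X_T)$ (quasi-surely).
   Context: Let $(\Omega,\mathcal{F})$ be a measurable space with a discrete-time filtration $\{\mathcal{F}_t\}_{t\in\mathbb{N}}$, $\mathbb{N}=\{0,1,2,\dots\}$, such that $\mathcal{F}=\mathcal{F}_\infty=\sigma(\bigcup_t\mathcal{F}_t)$ and $\mathcal{F}_0$ is trivial. $m\mathcal{F}_t$ denotes the $\mathcal{F}_t$-measurable $\mathbb{R}\cup\{\pm\infty\}$-valued functions. $\mathcal{H}$ is a linear space of $\mathcal{F}$-measurable $\mathbb{R}$-valued functions on $\Omega$ containing the constants, such that $X\in\mathcal{H}$ implies $|X|\in\mathcal{H}$ and $I_AX\in\mathcal{H}$ for all $A\in\mathcal{F}$; $\mathcal{H}_t:=\mathcal{H}\cap m\mathcal{F}_t$. $\mathcal{E}$ is an $\mathcal{SL}$-expectation: a family of maps $\mathcal{E}_t:\mathcal{H}\to\mathcal{H}_t$ such that for all $X,Y\in\mathcal{H}$, $s\le t$: (i) $X\ge Y$ implies $\mathcal{E}_t(X)\ge\mathcal{E}_t(Y)$; (ii) $\mathcal{E}_s(Y)=\mathcal{E}_s(\mathcal{E}_t(Y))$; (iii) $\mathcal{E}_t(I_AY)=I_A\mathcal{E}_t(Y)$ for $A\in\mathcal{F}_t$; (iv) $\mathcal{E}_t(Y)=Y$ for $Y\in\mathcal{H}_t$; (v) $\mathcal{E}_t(X+Y)\le\mathcal{E}_t(X)+\mathcal{E}_t(Y)$;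 (vi) $\mathcal{E}_t(\lambda Y)=\lambda^+\mathcal{E}_t(Y)+\lambda^-\mathcal{E}_t(-Y)$ for $\lambda\in\mathcal{H}_t$ with $\lambda Y\in\mathcal{H}$; (vii) if $X_i\in\mathcal{H}$ and $X_i(\omega)\downarrow0$ for every $\omega$, then $\mathcal{E}_0(X_i)\to0$. Write $\mathcal{E}=\mathcal{E}_0$ (real-valued). Such $\mathcal{E}$ has a representation $\mathcal{E}(Y)=\sup_{\theta\in\Theta}E_\theta[Y]$ for a collection $\Theta$ of ($\sigma$-additive) probability measures. A statement holds quasi-surely (q.s.) if it holds outside a set $N$ with $\mathcal{E}(I_N)=0$. $L^1$ is the completion of $\{X\in\mathcal{H}:\mathcal{E}(|X|)<\infty\}$ under $\|X\|_1=\mathcal{E}(|X|)$, modulo equality in $\|\cdot\|_1$; its elements are regarded as $\mathcal{F}$-measurable functions (up to q.s. equality), and each $\mathcal{E}_t$ extends to $L^1$ by $\mathcal{E}_t(X)=\lim\mathcal{E}_t(X_n)$ (limit in $L^1$) for $X_n\to X$ in $L^1$. An $\mathcal{SL}$-submartingale is a process $X$ with $X_t\in L^1\cap m\mathcal{F}_t$ for all $t$ and $X_s\le\mathcal{E}_s(X_t)$ for all $s\le t$ (relations in $L^1$ are understood q.s.). For a stopping time $S$, $\mathcal{E}_S(\cdot)(\omega):=\mathcal{E}_{S(\omega)}(\cdot)(\omega)$. *)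

theory Defs
  imports "HOL-Probability.Stopping_Time"
begin

text \<open>
  The sample space is a set \<open>\<Omega>\<close>; functions on it are functions on the ambient type, and only
  their values on \<open>\<Omega>\<close> matter. The measures \<open>F t\<close> are used only as measurable spaces.
\<close>

definition F_infty :: "'a set \<Rightarrow> (nat \<Rightarrow> 'a measure) \<Rightarrow> 'a measure" where
  "F_infty \<Omega> F = sigma \<Omega> (\<Union>t. sets (F t))"

locale SL_space = filtration \<Omega> F
  for \<Omega> :: "'a set" and F :: "nat \<Rightarrow> 'a measure" +
  fixes H :: "('a \<Rightarrow> real) set"
  assumes nonempty: "\<Omega> \<noteq> {}"
    and F0_trivial: "sets (F 0) = {{}, \<Omega>}"
    and H_measurable: "X \<in> H \<Longrightarrow> X \<in> borel_measurable (F_infty \<Omega> F)"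
    and H_const: "(\<lambda>_. c) \<in> H"
    and H_add: "X \<in> H \<Longrightarrow> Y \<in> H \<Longrightarrow> (\<lambda>\<omega>. X \<omega> + Y \<omega>) \<in> H"
    and H_scale: "X \<in> H \<Longrightarrow> (\<lambda>\<omega>. c * X \<omega>) \<in> H"
    and H_abs: "X \<in> H \<Longrightarrow> (\<lambda>\<omega>. \<bar>X \<omega>\<bar>) \<in> H"
    and H_indicator:
      "A \<in> sets (F_infty \<Omega> F) \<Longrightarrow> X \<in> H \<Longrightarrow> (\<lambda>\<omega>. indicat_real A \<omega> * X \<omega>) \<in> H"

definition H_at :: "(nat \<Rightarrow> 'a measure) \<Rightarrow> ('a \<Rightarrow> real) set \<Rightarrow> nat \<Rightarrow> ('a \<Rightarrow> real) set" where
  "H_at F H t = H \<inter> borel_measurable (F t)"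

locale SL_expectation = SL_space \<Omega> F H
  for \<Omega> :: "'a set" and F :: "nat \<Rightarrow> 'a measure" and H :: "('a \<Rightarrow> real) set" +
  fixes E :: "nat \<Rightarrow> ('a \<Rightarrow> real) \<Rightarrow> ('a \<Rightarrow> real)"
  assumes E_in: "Y \<in> H \<Longrightarrow> E t Y \<in> H_at F H t"
    and E_mono: "\<lbrakk>X \<in> H; Y \<in> H; \<forall>\<omega>\<in>\<Omega>. X \<omega> \<ge> Y \<omega>; \<omega> \<in> \<Omega>\<rbrakk> \<Longrightarrow> E t X \<omega> \<ge> E t Y \<omega>"
    and E_tower: "\<lbrakk>Y \<in> H; s \<le> t; \<omega> \<in> \<Omega>\<rbrakk> \<Longrightarrow> E s Y \<omega> = E s (E t Y) \<omega>"
    and E_local: "\<lbrakk>Y \<in> H; A \<in> sets (F t); \<omega> \<in> \<Omega>\<rbrakk> \<Longrightarrow>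
        E t (\<lambda>x. indicat_real A x * Y x) \<omega> = indicat_real A \<omega> * E t Y \<omega>"
    and E_id: "\<lbrakk>Y \<in> H_at F H t; \<omega> \<in> \<Omega>\<rbrakk> \<Longrightarrow> E t Y \<omega> = Y \<omega>"
    and E_subadd: "\<lbrakk>X \<in> H; Y \<in> H; \<omega> \<in> \<Omega>\<rbrakk> \<Longrightarrow> E t (\<lambda>x. X x + Y x) \<omega> \<le> E t X \<omega> + E t Y \<omega>"
    and E_homog: "\<lbrakk>Y \<in> H; l \<in> H_at F H t; (\<lambda>x. l x * Y x) \<in> H; \<omega> \<in> \<Omega>\<rbrakk> \<Longrightarrow>
        E t (\<lambda>x. l x * Y x) \<omega> =
          max (l \<omega>) 0 * E t Y \<omega> + max (- l \<omega>) 0 * E t (\<lambda>x. - Y x) \<omega>"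
    and E_cont: "\<lbrakk>\<And>i. Xs i \<in> H;
        \<forall>\<omega>\<in>\<Omega>. decseq (\<lambda>i. Xs i \<omega>) \<and> (\<lambda>i. Xs i \<omega>) \<longlonglongrightarrow> 0; \<omega> \<in> \<Omega>\<rbrakk> \<Longrightarrow>
        (\<lambda>i. E 0 (Xs i) \<omega>) \<longlonglongrightarrow> 0"

text \<open>
  As \<open>F 0\<close> is trivial and \<open>\<Omega>\<close> is nonempty, \<open>E 0 Y\<close> is constant on \<open>\<Omega>\<close> for \<open>Y \<in> H\<close>;
  the real number \<open>\<E>(Y)\<close> is that constant.
\<close>

definition E_real ::
  "'a set \<Rightarrow> (nat \<Rightarrow> ('a \<Rightarrow> real) \<Rightarrow> ('a \<Rightarrow> real)) \<Rightarrow> ('a \<Rightarrow> real) \<Rightarrow> real" where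
  "E_real \<Omega> E Y = (THE c. \<forall>\<omega>\<in>\<Omega>. E 0 Y \<omega> = c)"

definition quasi_surely :: "'a set \<Rightarrow> (nat \<Rightarrow> 'a measure) \<Rightarrow>
    (nat \<Rightarrow> ('a \<Rightarrow> real) \<Rightarrow> ('a \<Rightarrow> real)) \<Rightarrow> ('a \<Rightarrow> bool) \<Rightarrow> bool" where
  "quasi_surely \<Omega> F E P \<longleftrightarrow>
     (\<exists>N \<in> sets (F_infty \<Omega> F). E_real \<Omega> E (indicat_real N) = 0 \<and> (\<forall>\<omega> \<in> \<Omega> - N. P \<omega>))"

definition L1_norm ::
  "'a set \<Rightarrow> (nat \<Rightarrow> ('a \<Rightarrow> real) \<Rightarrow> ('a \<Rightarrow> real)) \<Rightarrow> ('a \<Rightarrow> real) \<Rightarrow> real" where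
  "L1_norm \<Omega> E Y = E_real \<Omega> E (\<lambda>\<omega>. \<bar>Y \<omega>\<bar>)"

text \<open>
  Since \<open>E 0\<close> is real valued, every element of \<open>H\<close> has finite norm, so \<open>L\<^sup>1\<close> is the completion of
  \<open>H\<close>. An element of the completion is the class of a Cauchy sequence in \<open>H\<close>. By the
  Borel-Cantelli argument such a sequence has a quasi-surely convergent subsequence, whose limit
  depends, up to quasi-sure equality, only on the class; this limit is the measurable function
  that the element is regarded as. So \<open>L1_conv \<Omega> F H E Xs X\<close> says that \<open>Xs n \<in> H\<close> converges in
  \<open>L\<^sup>1\<close> to the element regarded as the function \<open>X\<close>.
\<close>

definition L1_conv :: "'a set \<Rightarrow> (nat \<Rightarrow> 'a measure) \<Rightarrow> ('a \<Rightarrow> real) set \<Rightarrow>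
    (nat \<Rightarrow> ('a \<Rightarrow> real) \<Rightarrow> ('a \<Rightarrow> real)) \<Rightarrow> (nat \<Rightarrow> 'a \<Rightarrow> real) \<Rightarrow> ('a \<Rightarrow> ereal) \<Rightarrow> bool" where
  "L1_conv \<Omega> F H E Xs X \<longleftrightarrow>
     (\<forall>n. Xs n \<in> H) \<and>
     (\<forall>e>0. \<exists>N. \<forall>m\<ge>N. \<forall>n\<ge>N. L1_norm \<Omega> E (\<lambda>\<omega>. Xs m \<omega> - Xs n \<omega>) < e) \<and>
     X \<in> borel_measurable (F_infty \<Omega> F) \<and>
     (\<exists>r. strict_mono r \<and>
        quasi_surely \<Omega> F E (\<lambda>\<omega>. (\<lambda>k. ereal (Xs (r k) \<omega>)) \<longlonglongrightarrow> X \<omega>))"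

definition L1 :: "'a set \<Rightarrow> (nat \<Rightarrow> 'a measure) \<Rightarrow> ('a \<Rightarrow> real) set \<Rightarrow>
    (nat \<Rightarrow> ('a \<Rightarrow> real) \<Rightarrow> ('a \<Rightarrow> real)) \<Rightarrow> ('a \<Rightarrow> ereal) set" where
  "L1 \<Omega> F H E = {X. \<exists>Xs. L1_conv \<Omega> F H E Xs X}"

text \<open>
  The extension of \<open>E t\<close> to \<open>L\<^sup>1\<close> is determined up to quasi-sure equality; we fix an
  \<open>F t\<close>-measurable version (it exists because every \<open>E t (Xs n)\<close> is \<open>F t\<close>-measurable).
\<close>

definition E_ext :: "'a set \<Rightarrow> (nat \<Rightarrow> 'a measure) \<Rightarrow> ('a \<Rightarrow> real) set \<Rightarrow>
    (nat \<Rightarrow> ('a \<Rightarrow> real) \<Rightarrow> ('a \<Rightarrow> real)) \<Rightarrow> nat \<Rightarrow> ('a \<Rightarrow> ereal) \<Rightarrow> ('a \<Rightarrow> ereal)" where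
  "E_ext \<Omega> F H E t X =
     (SOME Y. Y \<in> borel_measurable (F t) \<and>
        (\<exists>Xs. L1_conv \<Omega> F H E Xs X \<and> L1_conv \<Omega> F H E (\<lambda>n. E t (Xs n)) Y))"

definition SL_submartingale :: "'a set \<Rightarrow> (nat \<Rightarrow> 'a measure) \<Rightarrow> ('a \<Rightarrow> real) set \<Rightarrow>
    (nat \<Rightarrow> ('a \<Rightarrow> real) \<Rightarrow> ('a \<Rightarrow> real)) \<Rightarrow> (nat \<Rightarrow> 'a \<Rightarrow> ereal) \<Rightarrow> bool" where
  "SL_submartingale \<Omega> F H E X \<longleftrightarrow>
     (\<forall>t. X t \<in> L1 \<Omega> F H E \<inter> borel_measurable (F t)) \<and>
     (\<forall>s t. s \<le> t \<longrightarrow> quasi_surely \<Omega> F E (\<lambda>\<omega>. X s \<omega> \<le> E_ext \<Omega> F H E s (X t) \<omega>))"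

definition at_time :: "(nat \<Rightarrow> 'a \<Rightarrow> ereal) \<Rightarrow> ('a \<Rightarrow> nat) \<Rightarrow> 'a \<Rightarrow> ereal" where
  "at_time X T \<omega> = X (T \<omega>) \<omega>"

definition E_stop :: "'a set \<Rightarrow> (nat \<Rightarrow> 'a measure) \<Rightarrow> ('a \<Rightarrow> real) set \<Rightarrow>
    (nat \<Rightarrow> ('a \<Rightarrow> real) \<Rightarrow> ('a \<Rightarrow> real)) \<Rightarrow> ('a \<Rightarrow> nat) \<Rightarrow> ('a \<Rightarrow> ereal) \<Rightarrow> ('a \<Rightarrow> ereal)" where
  "E_stop \<Omega> F H E S Z \<omega> = E_ext \<Omega> F H E (S \<omega>) Z \<omega>"

end

theory Submission
  imports Defs
begin

text \<open>
  Continuity from above turns \<open>\<E>\<close> into a countably subadditive functional for which Borel-Cantelli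
  and Fatou's lemma hold. Hence an element of \<open>L\<^sup>1\<close> is determined by its limit function, and the
  extended \<open>\<E>\<^sub>t\<close> is monotone, local on \<open>\<F>\<^sub>t\<close> and satisfies the tower inequality
  \<open>\<E>\<^sub>s (\<E>\<^sub>t X) \<le> \<E>\<^sub>s X\<close>. If \<open>T \<le> n\<close>, then \<open>X\<^sub>s \<le> \<E>\<^sub>s(X\<^sub>T)\<close> on \<open>{s \<le> T}\<close> by backward induction
  on \<open>s\<close>: on \<open>{T = s}\<close> it is \<open>X\<^sub>s \<le> \<E>\<^sub>s(X\<^sub>s)\<close>, and on \<open>{T > s}\<close>, which lies in \<open>\<F>\<^sub>s\<close>,
  \<open>X\<^sub>s \<le> \<E>\<^sub>s(X\<^bsub>s+1\<^esub>) \<le> \<E>\<^sub>s(\<E>\<^bsub>s+1\<^esub>(X\<^sub>T)) \<le> \<E>\<^sub>s(X\<^sub>T)\<close>. Specialise to \<open>s = S \<omega>\<close>.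
\<close>

section \<open>Fast subsequences of real sequences\<close>

text \<open>Serves to extract subsequences whose k-th requirement, later a norm bound
  \<open>(1/4) ^ k\<close>, is met from the k-th chosen index on.\<close>

lemma strict_mono_choice:
  fixes P :: "nat \<Rightarrow> nat \<Rightarrow> bool"
  assumes "\<And>k. \<forall>\<^sub>F n in sequentially. P k n"
  obtains r where "strict_mono r" "\<And>k. \<forall>n\<ge>r k. P k n"
proof -
  have "\<forall>k. \<exists>N. \<forall>n\<ge>N. P k n"
    using assms by (simp add: eventually_sequentially)
  then obtain N where N: "\<And>k n. N k \<le> n \<Longrightarrow> P k n" by metis
  \<comment> \<open>The partial sums of \<open>N\<close> dominate every \<open>N k\<close> and never
    decrease; the summand \<open>k\<close> makes the growth strict.\<close>
  define r where "r k = k + (\<Sum>j\<le>k. N j)" for k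
  have "strict_mono r"
    unfolding strict_mono_Suc_iff r_def by simp
  moreover have "N k \<le> r k" for k
    using member_le_sum[of k "{..k}" N] unfolding r_def by simp
  ultimately show ?thesis using that[of r] N by (meson order_trans)
qed

text \<open>Up to the constant \<open>f 0\<close>, the sequence consists of the partial sums of its
  increments, and these are dominated by a geometric series.\<close>

lemma convergent_of_geometric_increments:
  fixes f :: "nat \<Rightarrow> real"
  assumes "\<forall>\<^sub>F k in sequentially. \<bar>f (Suc k) - f k\<bar> \<le> (1/2) ^ k"
  shows "convergent f"
proof -
  have "summable (\<lambda>k. f (Suc k) - f k)"
    by (rule summable_comparison_test_ev[where g = "\<lambda>k. (1/2) ^ k"]) (use assms in auto)
  then have "convergent (\<lambda>n. f n - f 0)"
    by (simp add: summable_iff_convergent sum_lessThan_telescope)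
  then show ?thesis
    by (simp add: convergent_diff_const_right_iff)
qed

context SL_expectation
begin

abbreviation "G \<equiv> F_infty \<Omega> F"
abbreviation "e \<equiv> E_real \<Omega> E"
abbreviation "qs \<equiv> quasi_surely \<Omega> F E"
abbreviation "conv \<equiv> L1_conv \<Omega> F H E"
abbreviation "ext \<equiv> E_ext \<Omega> F H E"

subsection \<open>The sublinear functional at time zero\<close>

lemma sets_F_Pow: "(\<Union>t. sets (F t)) \<subseteq> Pow \<Omega>"
  using sets.sets_into_space space_F by fastforce

lemma space_G [simp]: "space G = \<Omega>"
  unfolding F_infty_def by (rule space_measure_of[OF sets_F_Pow])

lemma sets_F_subset_G: "sets (F t) \<subseteq> sets G"
  unfolding F_infty_def sets_measure_of[OF sets_F_Pow] by blast

lemma borel_F_imp_G: "f \<in> borel_measurable (F t) \<Longrightarrow> f \<in> borel_measurable G"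
  by (rule measurable_mono[THEN subsetD, of borel borel "F t" G])
     (use sets_F_subset_G in \<open>auto simp: space_F\<close>)

lemma H_indicat_real [intro]: "A \<in> sets G \<Longrightarrow> indicat_real A \<in> H"
  using H_indicator[OF _ H_const[of 1]] by simp

lemma H_minus: "X \<in> H \<Longrightarrow> (\<lambda>\<omega>. - X \<omega>) \<in> H"
  using H_scale[of X "-1"] by simp

lemma H_diff: "X \<in> H \<Longrightarrow> Y \<in> H \<Longrightarrow> (\<lambda>\<omega>. X \<omega> - Y \<omega>) \<in> H"
  using H_add[OF _ H_minus, of X Y] by simp

text \<open>Closure under absolute values yields lattice operations through max(x, y) = (x + y + |x
  - y|) / 2.\<close>

lemma H_max:
  assumes "X \<in> H" "Y \<in> H" shows "(\<lambda>\<omega>. max (X \<omega>) (Y \<omega>)) \<in> H"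
proof -
  have "(\<lambda>\<omega>. max (X \<omega>) (Y \<omega>)) = (\<lambda>\<omega>. (1/2) * ((X \<omega> + Y \<omega>) + \<bar>X \<omega> - Y \<omega>\<bar>))"
    by (auto simp: fun_eq_iff max_def abs_if)
  then show ?thesis
    using H_scale[OF H_add[OF H_add[OF assms] H_abs[OF H_diff[OF assms]]], of "1/2"] by simp
qed

lemma H_sum: "finite I \<Longrightarrow> (\<And>i. i \<in> I \<Longrightarrow> X i \<in> H) \<Longrightarrow> (\<lambda>\<omega>. \<Sum>i\<in>I. X i \<omega>) \<in> H"
  by (induction I rule: finite_induct) (auto intro: H_add H_const)

lemma E_H: "Y \<in> H \<Longrightarrow> E t Y \<in> H"
  using E_in[of Y t] by (simp add: H_at_def)

text \<open>Triviality of \<open>F 0\<close> forces the level set of \<open>E 0 Y\<close> through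
  \<omega> to be all of \<Omega>. So the definite description in \<open>E_real\<close> denotes, and
  identities for \<open>E 0\<close> at any one point become identities for \<open>e\<close>.\<close>

lemma E0_eq:
  assumes Y: "Y \<in> H" and \<omega>: "\<omega> \<in> \<Omega>"
  shows "E 0 Y \<omega> = e Y"
proof -
  have m: "E 0 Y \<in> borel_measurable (F 0)"
    using E_in[OF Y] by (simp add: H_at_def)
  have c: "E 0 Y \<omega>' = E 0 Y \<omega>" if "\<omega>' \<in> \<Omega>" for \<omega>'
  proof -
    have "{x \<in> space (F 0). E 0 Y x = E 0 Y \<omega>} \<in> sets (F 0)"
      using m by measurable
    then show ?thesis using F0_trivial \<omega> that by (auto simp: space_F)
  qed
  have "(THE c. \<forall>\<omega>'\<in>\<Omega>. E 0 Y \<omega>' = c) = E 0 Y \<omega>"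
    using c \<omega> by (intro the_equality) metis+
  then show ?thesis by (simp add: E_real_def)
qed

lemma e_mono: "X \<in> H \<Longrightarrow> Y \<in> H \<Longrightarrow> (\<And>\<omega>. \<omega> \<in> \<Omega> \<Longrightarrow> X \<omega> \<le> Y \<omega>) \<Longrightarrow> e X \<le> e Y"
  using some_in_eq[of \<Omega>] nonempty E_mono[of Y X "SOME \<omega>. \<omega> \<in> \<Omega>" 0] by (simp add: E0_eq)

lemma e_add: "X \<in> H \<Longrightarrow> Y \<in> H \<Longrightarrow> e (\<lambda>\<omega>. X \<omega> + Y \<omega>) \<le> e X + e Y"
  using some_in_eq[of \<Omega>] nonempty E_subadd[of X Y "SOME \<omega>. \<omega> \<in> \<Omega>" 0] by (simp add: E0_eq H_add)

lemma e_const [simp]: "e (\<lambda>_. c) = c"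
proof -
  obtain \<omega> where "\<omega> \<in> \<Omega>" using nonempty by auto
  then show ?thesis
    using E_id[of "\<lambda>_. c" 0 \<omega>] E0_eq[OF H_const[of c]] by (simp add: H_at_def H_const)
qed

lemma e_scale:
  assumes "X \<in> H" "0 \<le> c" shows "e (\<lambda>\<omega>. c * X \<omega>) = c * e X"
proof -
  obtain \<omega> where "\<omega> \<in> \<Omega>" using nonempty by auto
  then show ?thesis
    using E_homog[of X "\<lambda>_. c" 0 \<omega>] assms E0_eq[of X \<omega>] E0_eq[OF H_scale, of X \<omega> c]
    by (simp add: H_at_def H_const H_scale)
qed

lemma e_nonneg: "X \<in> H \<Longrightarrow> (\<And>\<omega>. \<omega> \<in> \<Omega> \<Longrightarrow> 0 \<le> X \<omega>) \<Longrightarrow> 0 \<le> e X"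
  using e_mono[OF H_const[of 0], of X] by simp

lemma e_sum:
  assumes "finite I" "\<And>i. i \<in> I \<Longrightarrow> X i \<in> H"
  shows "e (\<lambda>\<omega>. \<Sum>i\<in>I. X i \<omega>) \<le> (\<Sum>i\<in>I. e (X i))"
  using assms
proof (induction I rule: finite_induct)
  case (insert i I)
  then show ?case
    using e_add[of "X i" "\<lambda>\<omega>. \<Sum>i\<in>I. X i \<omega>"] H_sum[of I X] by fastforce
qed simp

lemma e_tower: "Y \<in> H \<Longrightarrow> e (E t Y) = e Y"
  using some_in_eq[of \<Omega>] nonempty E_tower[of Y 0 t "SOME \<omega>. \<omega> \<in> \<Omega>"] by (simp add: E0_eq E_H)

lemma e_tendsto_0:
  assumes "\<And>i. Xs i \<in> H"
    and "\<And>\<omega>. \<omega> \<in> \<Omega> \<Longrightarrow> decseq (\<lambda>i. Xs i \<omega>)" "\<And>\<omega>. \<omega> \<in> \<Omega> \<Longrightarrow> (\<lambda>i. Xs i \<omega>) \<longlonglongrightarrow> 0"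
  shows "(\<lambda>i. e (Xs i)) \<longlonglongrightarrow> 0"
proof -
  obtain \<omega> where "\<omega> \<in> \<Omega>" using nonempty by auto
  then show ?thesis
    using E_cont[of Xs \<omega>] assms E0_eq by simp
qed

text \<open>Every point eventually leaves the sets \<open>B m\<close>, so the products decrease
  pointwise to 0 and continuity from above applies.\<close>

lemma e_indicator_tendsto_0:
  assumes "\<And>m. B m \<in> sets G" "decseq B" "(\<Inter>m. B m) = {}" and Y: "Y \<in> H" "\<And>\<omega>. \<omega> \<in> \<Omega> \<Longrightarrow> 0 \<le> Y \<omega>"
  shows "(\<lambda>m. e (\<lambda>\<omega>. indicat_real (B m) \<omega> * Y \<omega>)) \<longlonglongrightarrow> 0"
proof (rule e_tendsto_0)
  fix \<omega> assume \<omega>: "\<omega> \<in> \<Omega>"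
  show "decseq (\<lambda>i. indicat_real (B i) \<omega> * Y \<omega>)"
    unfolding decseq_def
    by (intro allI impI mult_right_mono Y \<omega>)
       (use decseqD[OF assms(2)] in \<open>auto simp: indicator_def\<close>)
  obtain m where m: "\<omega> \<notin> B m" using assms(3) by auto
  have "indicat_real (B i) \<omega> * Y \<omega> = 0" if "i \<ge> m" for i
    using m decseqD[OF assms(2) that] by (auto simp: indicator_def)
  then have "\<forall>\<^sub>F i in sequentially. indicat_real (B i) \<omega> * Y \<omega> = 0"
    by (auto simp: eventually_sequentially)
  then show "(\<lambda>i. indicat_real (B i) \<omega> * Y \<omega>) \<longlonglongrightarrow> 0"
    by (rule tendsto_eventually)
qed (use assms H_indicator in auto)

text \<open>Since \<open>Y\<close> may be unbounded, it is truncated: \<open>indicat_real N\<close>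
  times \<open>Y\<close> is at most \<open>k\<close> times the indicator, which has expectation 0,
  plus the positive part of \<open>Y - k\<close>, whose expectation tends to 0 by continuity from
  above.\<close>

lemma e_indicator_null:
  assumes N: "N \<in> sets G" "e (indicat_real N) = 0" and Y: "Y \<in> H" "\<And>\<omega>. \<omega> \<in> \<Omega> \<Longrightarrow> 0 \<le> Y \<omega>"
  shows "e (\<lambda>\<omega>. indicat_real N \<omega> * Y \<omega>) = 0"
proof -
  have H1: "(\<lambda>\<omega>. max (Y \<omega> - real k) 0) \<in> H" for k
    using H_max[OF H_diff[OF Y(1) H_const] H_const] by simp
  have HN: "indicat_real N \<in> H" using N by auto
  have "(\<lambda>k. e (\<lambda>\<omega>. max (Y \<omega> - real k) 0)) \<longlonglongrightarrow> 0"
  proof (rule e_tendsto_0[OF H1])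
    fix \<omega>
    show "decseq (\<lambda>i. max (Y \<omega> - real i) 0)" by (auto simp: decseq_def)
    obtain m where "Y \<omega> \<le> real m" using real_arch_simple by blast
    then have "\<forall>\<^sub>F i in sequentially. max (Y \<omega> - real i) 0 = 0"
      by (auto simp: eventually_sequentially intro!: exI[of _ m])
    then show "(\<lambda>i. max (Y \<omega> - real i) 0) \<longlonglongrightarrow> 0" by (rule tendsto_eventually)
  qed
  moreover have "e (\<lambda>\<omega>. indicat_real N \<omega> * Y \<omega>) \<le> e (\<lambda>\<omega>. max (Y \<omega> - real k) 0)" for k
  proof -
    have "e (\<lambda>\<omega>. indicat_real N \<omega> * Y \<omega>)
        \<le> e (\<lambda>\<omega>. real k * indicat_real N \<omega> + max (Y \<omega> - real k) 0)"
      by (intro e_mono H_add H_scale H1 H_indicator HN N Y) (auto simp: indicator_def)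
    also have "\<dots> \<le> e (\<lambda>\<omega>. real k * indicat_real N \<omega>) + e (\<lambda>\<omega>. max (Y \<omega> - real k) 0)"
      by (intro e_add H_scale H1 HN)
    finally show ?thesis using e_scale[OF HN, of "real k"] N by simp
  qed
  ultimately have "e (\<lambda>\<omega>. indicat_real N \<omega> * Y \<omega>) \<le> 0"
    by (intro LIMSEQ_le_const) auto
  moreover have "0 \<le> e (\<lambda>\<omega>. indicat_real N \<omega> * Y \<omega>)"
    by (intro e_nonneg H_indicator N Y) (auto simp: indicator_def Y)
  ultimately show ?thesis by simp
qed

text \<open>Countable subadditivity: finite subadditivity handles the first \<open>m\<close> sets,
  and continuity from above makes the rest negligible.\<close>

lemma e_indicator_UN_le:
  fixes A :: "nat \<Rightarrow> 'a set"
  assumes A: "\<And>i. A i \<in> sets G" and a: "\<And>i. e (indicat_real (A i)) \<le> a i" "summable a"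
  shows "e (indicat_real (\<Union>i. A i)) \<le> suminf a"
proof -
  \<comment> \<open>The remainder after \<open>m\<close> sets. A point of \<open>A i\<close> is
    absent from \<open>B m\<close> as soon as \<open>m > i\<close>, so the remainders decrease to
    the empty set.\<close>
  define B where "B m = (\<Union>i. A i) - (\<Union>i<m. A i)" for m
  have B: "B m \<in> sets G" for m unfolding B_def using A by auto
  have HA: "indicat_real (A i) \<in> H" for i using A by auto
  have dec: "decseq B" unfolding B_def decseq_def by fastforce
  have inter: "(\<Inter>m. B m) = {}" unfolding B_def by fastforce
  have lim: "(\<lambda>m. e (indicat_real (B m))) \<longlonglongrightarrow> 0"
    using e_indicator_tendsto_0[OF B dec inter H_const[of 1]] by simp
  have nn: "0 \<le> a i" for i
    using a(1)[of i] e_nonneg[OF HA[of i]] by simp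
  have "e (indicat_real (\<Union>i. A i)) \<le> e (indicat_real (B m)) + suminf a" for m
  proof -
    have "e (indicat_real (\<Union>i. A i))
        \<le> e (\<lambda>\<omega>. indicat_real (B m) \<omega> + (\<Sum>i<m. indicat_real (A i) \<omega>))"
    proof (intro e_mono H_add H_sum)
      fix \<omega>
      show "indicat_real (\<Union>i. A i) \<omega> \<le> indicat_real (B m) \<omega> + (\<Sum>i<m. indicat_real (A i) \<omega>)"
      proof (cases "\<exists>i<m. \<omega> \<in> A i")
        case True
        then obtain i where "i < m" "\<omega> \<in> A i" by auto
        then have "1 \<le> (\<Sum>i<m. indicat_real (A i) \<omega>)"
          using member_le_sum[of i "{..<m}" "\<lambda>i. indicat_real (A i) \<omega>"] by auto
        then show ?thesis by (auto simp: indicator_def intro: order_trans)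
      next
        case False
        then have "indicat_real (\<Union>i. A i) \<omega> = indicat_real (B m) \<omega>"
          unfolding B_def by (auto simp: indicator_def)
        then show ?thesis by (simp add: sum_nonneg)
      qed
    qed (use A B in auto)
    also have "\<dots> \<le> e (indicat_real (B m)) + e (\<lambda>\<omega>. \<Sum>i<m. indicat_real (A i) \<omega>)"
      by (intro e_add H_sum) (use A B in auto)
    also have "e (\<lambda>\<omega>. \<Sum>i<m. indicat_real (A i) \<omega>) \<le> (\<Sum>i<m. e (indicat_real (A i)))"
      by (intro e_sum HA) auto
    also have "\<dots> \<le> (\<Sum>i<m. a i)" by (intro sum_mono a)
    also have "\<dots> \<le> suminf a" by (intro sum_le_suminf a) (use nn in auto)
    finally show ?thesis by simp
  qed
  moreover have "(\<lambda>m. e (indicat_real (B m)) + suminf a) \<longlonglongrightarrow> 0 + suminf a"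
    by (intro tendsto_intros lim)
  ultimately show ?thesis
    using LIMSEQ_le_const[of "\<lambda>m. e (indicat_real (B m)) + suminf a" "0 + suminf a"] by simp
qed

subsection \<open>Quasi-sure statements\<close>

lemma qs_mono: "qs P \<Longrightarrow> (\<And>\<omega>. \<omega> \<in> \<Omega> \<Longrightarrow> P \<omega> \<Longrightarrow> Q \<omega>) \<Longrightarrow> qs Q"
  unfolding quasi_surely_def by blast

text \<open>A countable union of null sets is null, by countable subadditivity with all bounds equal
  to 0.\<close>

lemma qs_all:
  assumes "\<And>i::nat. qs (P i)" shows "qs (\<lambda>\<omega>. \<forall>i. P i \<omega>)"
proof -
  have "\<forall>i. \<exists>N. N \<in> sets G \<and> e (indicat_real N) = 0 \<and> (\<forall>\<omega>\<in>\<Omega> - N. P i \<omega>)"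
    using assms unfolding quasi_surely_def by blast
  then obtain N where N: "\<And>i. N i \<in> sets G" "\<And>i. e (indicat_real (N i)) = 0"
    "\<And>i \<omega>. \<omega> \<in> \<Omega> - N i \<Longrightarrow> P i \<omega>" by metis
  have U: "(\<Union>i. N i) \<in> sets G" using N(1) by auto
  have "e (indicat_real (\<Union>i. N i)) \<le> 0"
    using e_indicator_UN_le[OF N(1), where a = "\<lambda>_. 0"] N(2) by simp
  moreover have "0 \<le> e (indicat_real (\<Union>i. N i))" using U by (intro e_nonneg) auto
  ultimately show ?thesis
    unfolding quasi_surely_def using U N(3) by (intro bexI[of _ "\<Union>i. N i"]) auto
qed

lemma qs_conj:
  assumes "qs P" "qs Q" shows "qs (\<lambda>\<omega>. P \<omega> \<and> Q \<omega>)"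
proof -
  have "qs (\<lambda>\<omega>. \<forall>i::nat. if i = 0 then P \<omega> else Q \<omega>)"
  proof (rule qs_all)
    show "qs (\<lambda>\<omega>. if i = 0 then P \<omega> else Q \<omega>)" for i :: nat
      using assms by (cases "i = 0") auto
  qed
  then show ?thesis by (rule qs_mono) (use zero_neq_one in metis)
qed

lemma qs_mono2:
  assumes "qs P" "qs Q" "\<And>\<omega>. \<omega> \<in> \<Omega> \<Longrightarrow> P \<omega> \<Longrightarrow> Q \<omega> \<Longrightarrow> R \<omega>"
  shows "qs R"
  by (rule qs_mono[OF qs_conj[OF assms(1,2)]]) (use assms(3) in blast)

lemma qs_mono3:
  assumes "qs P" "qs Q" "qs R" "\<And>\<omega>. \<omega> \<in> \<Omega> \<Longrightarrow> P \<omega> \<Longrightarrow> Q \<omega> \<Longrightarrow> R \<omega> \<Longrightarrow> S \<omega>"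
  shows "qs S"
  by (rule qs_mono2[OF qs_conj[OF assms(1,2)] assms(3)]) (use assms(4) in blast)

lemma qs_I: "(\<And>\<omega>. \<omega> \<in> \<Omega> \<Longrightarrow> P \<omega>) \<Longrightarrow> qs P"
  unfolding quasi_surely_def using e_const[of 0]
  by (intro bexI[of _ "{}"]) (auto simp: indicator_def[abs_def])

section \<open>Borel-Cantelli and Fatou for the sublinear functional\<close>

text \<open>The rate \<open>(1/4) ^ k\<close> is chosen so that Markov's inequality at level
  \<open>(1/2) ^ k\<close> still leaves the summable bound \<open>(1/2) ^ k\<close> on the
  exceptional sets.\<close>

lemma Borel_Cantelli_qs:
  assumes V: "\<And>k. V k \<in> H" and le: "\<And>k. e (\<lambda>\<omega>. \<bar>V k \<omega>\<bar>) \<le> (1/4) ^ k"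
  shows "qs (\<lambda>\<omega>. \<forall>\<^sub>F k in sequentially. \<bar>V k \<omega>\<bar> \<le> (1/2) ^ k)"
proof -
  have [measurable]: "V k \<in> borel_measurable G" for k
    using V H_measurable by auto
  define A where "A k = {\<omega> \<in> space G. (1/2) ^ k < \<bar>V k \<omega>\<bar>}" for k
  have A: "A k \<in> sets G" for k unfolding A_def by measurable
  have eA: "e (indicat_real (A k)) \<le> (1/2) ^ k" for k
  proof -
    have "e (indicat_real (A k)) \<le> e (\<lambda>\<omega>. 2 ^ k * \<bar>V k \<omega>\<bar>)"
    proof (intro e_mono H_scale H_abs V)
      fix \<omega>
      show "indicat_real (A k) \<omega> \<le> 2 ^ k * \<bar>V k \<omega>\<bar>"
        by (auto simp: A_def indicator_def power_one_over field_simps)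
    qed (use A in auto)
    also have "\<dots> = 2 ^ k * e (\<lambda>\<omega>. \<bar>V k \<omega>\<bar>)" by (intro e_scale H_abs V) auto
    also have "\<dots> \<le> 2 ^ k * (1/4) ^ k" by (intro mult_left_mono le) auto
    also have "\<dots> = (1/2) ^ k" by (simp flip: power_mult_distrib)
    finally show ?thesis .
  qed
  \<comment> \<open>The limit superior of the sets \<open>A k\<close>; it lies in every tail union,
    whose expectation is at most the geometric tail \<open>(1/2) ^ m * 2\<close>.\<close>
  define N where "N = (\<Inter>m. \<Union>i. A (m + i))"
  have N: "N \<in> sets G" unfolding N_def using A by auto
  have "e (indicat_real N) \<le> (1/2) ^ m * 2" for m
  proof -
    have "e (indicat_real N) \<le> e (indicat_real (\<Union>i. A (m + i)))"
      by (intro e_mono H_indicat_real N) (use A in \<open>auto simp: N_def indicator_def\<close>)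
    also have "\<dots> \<le> (\<Sum>i. (1/2) ^ (m + i))"
      by (intro e_indicator_UN_le A eA) (simp add: power_add)
    also have "\<dots> = (1/2) ^ m * 2"
      using suminf_mult[of "\<lambda>i. (1/2::real) ^ i" "(1/2) ^ m"] suminf_geometric[of "1/2::real"]
      by (simp add: power_add)
    finally show ?thesis .
  qed
  moreover have "(\<lambda>m. (1/2::real) ^ m * 2) \<longlonglongrightarrow> 0 * 2"
    by (intro tendsto_intros LIMSEQ_power_zero) auto
  ultimately have "e (indicat_real N) \<le> 0"
    using LIMSEQ_le_const[of "\<lambda>m. (1/2::real) ^ m * 2" "0 * 2" "e (indicat_real N)"] by simp
  moreover have "0 \<le> e (indicat_real N)" using N by (intro e_nonneg) auto
  moreover have "\<forall>\<^sub>F k in sequentially. \<bar>V k \<omega>\<bar> \<le> (1/2) ^ k" if "\<omega> \<in> \<Omega> - N" for \<omega>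
  proof -
    obtain m where m: "\<And>i. \<omega> \<notin> A (m + i)" using \<open>\<omega> \<in> \<Omega> - N\<close> by (auto simp: N_def)
    have "\<bar>V k \<omega>\<bar> \<le> (1/2) ^ k" if "k \<ge> m" for k
      using m[of "k - m"] that \<open>\<omega> \<in> \<Omega> - N\<close> by (auto simp: A_def)
    then show ?thesis by (auto simp: eventually_sequentially)
  qed
  ultimately show ?thesis
    unfolding quasi_surely_def using N by (intro bexI[of _ N]) auto
qed

text \<open>Outside the null set \<open>N\<close> and a set \<open>A m\<close> on which the
  approximation is still poor, \<open>Y\<close> is below \<open>Ys m + \<delta>\<close>. The sets
  \<open>A m\<close> decrease to the empty set, so the contribution of \<open>Y\<close> on them
  vanishes by continuity from above.\<close>

lemma e_Fatou:
  assumes Y: "Y \<in> H" "\<And>\<omega>. \<omega> \<in> \<Omega> \<Longrightarrow> 0 \<le> Y \<omega>"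
    and Ys: "\<And>k. Ys k \<in> H" "\<And>k \<omega>. \<omega> \<in> \<Omega> \<Longrightarrow> 0 \<le> Ys k \<omega>"
    and lim: "qs (\<lambda>\<omega>. (\<lambda>k. Ys k \<omega>) \<longlonglongrightarrow> Y \<omega>)"
    and le: "\<forall>\<^sub>F k in sequentially. e (Ys k) \<le> c"
  shows "e Y \<le> c"
proof (rule field_le_epsilon)
  fix \<delta> :: real assume \<delta>: "0 < \<delta>"
  have [measurable]: "Ys k \<in> borel_measurable G" "Y \<in> borel_measurable G" for k
    using Y Ys H_measurable by auto
  obtain N where N: "N \<in> sets G" "e (indicat_real N) = 0"
    "\<And>\<omega>. \<omega> \<in> \<Omega> - N \<Longrightarrow> (\<lambda>k. Ys k \<omega>) \<longlonglongrightarrow> Y \<omega>"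
    using lim unfolding quasi_surely_def by blast
  \<comment> \<open>Asking for some \<open>k \<ge> m\<close>, rather than \<open>k = m\<close>,
    makes the sets decreasing; removing \<open>N\<close> makes their intersection empty.\<close>
  define A where "A m = {\<omega> \<in> space G. \<exists>k\<ge>m. Ys k \<omega> + \<delta> \<le> Y \<omega>} - N" for m
  have A: "A m \<in> sets G" for m unfolding A_def using N(1) by measurable
  have dec: "decseq A" unfolding A_def decseq_def by (auto intro: order_trans)
  have "\<omega> \<notin> (\<Inter>m. A m)" for \<omega>
  proof
    assume a: "\<omega> \<in> (\<Inter>m. A m)"
    then have "(\<lambda>k. Ys k \<omega>) \<longlonglongrightarrow> Y \<omega>" using N(3) by (auto simp: A_def)
    then have "\<forall>\<^sub>F k in sequentially. Y \<omega> - \<delta> < Ys k \<omega>"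
      by (rule order_tendstoD) (use \<delta> in simp)
    then obtain m where "\<And>k. k \<ge> m \<Longrightarrow> Y \<omega> - \<delta> < Ys k \<omega>"
      by (auto simp: eventually_sequentially)
    then show False using a by (force simp: A_def)
  qed
  then have "(\<lambda>m. e (\<lambda>\<omega>. indicat_real (A m) \<omega> * Y \<omega>)) \<longlonglongrightarrow> 0"
    by (intro e_indicator_tendsto_0 A dec Y) auto
  then have lim2: "(\<lambda>m. c + \<delta> + e (\<lambda>\<omega>. indicat_real (A m) \<omega> * Y \<omega>)) \<longlonglongrightarrow> c + \<delta> + 0"
    by (intro tendsto_intros)
  have "e Y \<le> c + \<delta> + e (\<lambda>\<omega>. indicat_real (A m) \<omega> * Y \<omega>)" if m: "e (Ys m) \<le> c" for m
  proof -
    have h: "(\<lambda>\<omega>. indicat_real (A m) \<omega> * Y \<omega>) \<in> H" "(\<lambda>\<omega>. indicat_real N \<omega> * Y \<omega>) \<in> H"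
      using H_indicator A N Y by auto
    \<comment> \<open>On \<open>N\<close> and on \<open>A m\<close> the added copy of
      \<open>Y\<close> alone suffices, as all other terms are nonnegative; elsewhere the definition
      of \<open>A m\<close> with \<open>k = m\<close> gives the bound.\<close>
    have "e Y \<le> e (\<lambda>\<omega>. (Ys m \<omega> + \<delta>) + (indicat_real (A m) \<omega> * Y \<omega> + indicat_real N \<omega> * Y \<omega>))"
    proof (intro e_mono Y H_add H_const h Ys)
      fix \<omega> assume \<omega>: "\<omega> \<in> \<Omega>"
      consider "\<omega> \<in> N" | "\<omega> \<in> A m" | "\<omega> \<notin> N" "\<omega> \<notin> A m" by blast
      then show "Y \<omega> \<le> (Ys m \<omega> + \<delta>) + (indicat_real (A m) \<omega> * Y \<omega> + indicat_real N \<omega> * Y \<omega>)"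
      proof cases
        case 3
        then have "Y \<omega> < Ys m \<omega> + \<delta>" using \<omega> unfolding A_def by force
        then show ?thesis using 3 by simp
      qed (use \<omega> Y(2)[OF \<omega>] Ys(2)[OF \<omega>, of m] \<delta> in \<open>auto simp: indicator_def\<close>)
    qed
    also have "\<dots> \<le> e (\<lambda>\<omega>. Ys m \<omega> + \<delta>)
        + e (\<lambda>\<omega>. indicat_real (A m) \<omega> * Y \<omega> + indicat_real N \<omega> * Y \<omega>)"
      by (intro e_add H_add h H_const Ys)
    also have "e (\<lambda>\<omega>. Ys m \<omega> + \<delta>) \<le> e (Ys m) + e (\<lambda>_. \<delta>)"
      by (intro e_add H_const Ys)
    also have "e (\<lambda>\<omega>. indicat_real (A m) \<omega> * Y \<omega> + indicat_real N \<omega> * Y \<omega>)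
       \<le> e (\<lambda>\<omega>. indicat_real (A m) \<omega> * Y \<omega>) + e (\<lambda>\<omega>. indicat_real N \<omega> * Y \<omega>)"
      by (intro e_add h)
    also have "e (\<lambda>\<omega>. indicat_real N \<omega> * Y \<omega>) = 0"
      by (rule e_indicator_null[OF N(1,2) Y])
    finally show ?thesis using m by simp
  qed
  then have "\<forall>\<^sub>F m in sequentially. e Y \<le> c + \<delta> + e (\<lambda>\<omega>. indicat_real (A m) \<omega> * Y \<omega>)"
    using le by (auto elim: eventually_mono)
  from tendsto_lowerbound[OF lim2 this] show "e Y \<le> c + \<delta>" by simp
qed

subsection \<open>Cauchy sequences and their limits\<close>

lemma e_abs_diff_triangle:
  assumes "X \<in> H" "Y \<in> H" "Z \<in> H"
  shows "e (\<lambda>\<omega>. \<bar>X \<omega> - Z \<omega>\<bar>) \<le> e (\<lambda>\<omega>. \<bar>X \<omega> - Y \<omega>\<bar>) + e (\<lambda>\<omega>. \<bar>Y \<omega> - Z \<omega>\<bar>)"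
proof -
  have "e (\<lambda>\<omega>. \<bar>X \<omega> - Z \<omega>\<bar>) \<le> e (\<lambda>\<omega>. \<bar>X \<omega> - Y \<omega>\<bar> + \<bar>Y \<omega> - Z \<omega>\<bar>)"
    by (intro e_mono H_add H_abs H_diff assms) auto
  also have "\<dots> \<le> e (\<lambda>\<omega>. \<bar>X \<omega> - Y \<omega>\<bar>) + e (\<lambda>\<omega>. \<bar>Y \<omega> - Z \<omega>\<bar>)"
    by (intro e_add H_abs H_diff assms)
  finally show ?thesis .
qed

text \<open>The part of \<open>L1_conv\<close> that mentions no limit function, isolated because
  sequences such as \<open>E t (Xs n)\<close> are known to be Cauchy before a limit is
  available.\<close>

definition L1_Cauchy :: "(nat \<Rightarrow> 'a \<Rightarrow> real) \<Rightarrow> bool" where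
  "L1_Cauchy Xs \<longleftrightarrow> (\<forall>n. Xs n \<in> H) \<and>
     (\<forall>\<epsilon>>0. \<exists>N. \<forall>m\<ge>N. \<forall>n\<ge>N. e (\<lambda>\<omega>. \<bar>Xs m \<omega> - Xs n \<omega>\<bar>) < \<epsilon>)"

lemma conv_iff: "conv Xs X \<longleftrightarrow> L1_Cauchy Xs \<and> X \<in> borel_measurable G \<and>
    (\<exists>r. strict_mono r \<and> qs (\<lambda>\<omega>. (\<lambda>k. ereal (Xs (r k) \<omega>)) \<longlonglongrightarrow> X \<omega>))"
  by (auto simp: L1_conv_def L1_Cauchy_def L1_norm_def)

lemma L1_CauchyD: "L1_Cauchy Xs \<Longrightarrow> Xs n \<in> H"
  by (simp add: L1_Cauchy_def)

lemma L1_Cauchy_obtain: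
  assumes "L1_Cauchy Xs" "0 < \<epsilon>"
  obtains N where "\<And>m n. N \<le> m \<Longrightarrow> N \<le> n \<Longrightarrow> e (\<lambda>\<omega>. \<bar>Xs m \<omega> - Xs n \<omega>\<bar>) < \<epsilon>"
  using assms unfolding L1_Cauchy_def by blast

lemma L1_CauchyI:
  assumes "\<And>n. Xs n \<in> H"
    and "\<And>\<epsilon>. 0 < \<epsilon> \<Longrightarrow> \<exists>N. \<forall>m\<ge>N. \<forall>n\<ge>N. e (\<lambda>\<omega>. \<bar>Xs m \<omega> - Xs n \<omega>\<bar>) < \<epsilon>"
  shows "L1_Cauchy Xs"
  using assms unfolding L1_Cauchy_def by blast

lemma L1_Cauchy_subseq:
  assumes "L1_Cauchy Xs" "strict_mono (r :: nat \<Rightarrow> nat)"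
  shows "L1_Cauchy (\<lambda>k. Xs (r k))"
proof (rule L1_CauchyI)
  fix \<epsilon> :: real assume "0 < \<epsilon>"
  then obtain N where "\<And>m n. N \<le> m \<Longrightarrow> N \<le> n \<Longrightarrow> e (\<lambda>\<omega>. \<bar>Xs m \<omega> - Xs n \<omega>\<bar>) < \<epsilon>"
    using L1_Cauchy_obtain[OF assms(1)] by metis
  then show "\<exists>N. \<forall>m\<ge>N. \<forall>n\<ge>N. e (\<lambda>\<omega>. \<bar>Xs (r m) \<omega> - Xs (r n) \<omega>\<bar>) < \<epsilon>"
    using seq_suble[OF assms(2)] by (meson order_trans)
qed (use assms L1_CauchyD in auto)

text \<open>Completeness in the quasi-sure sense: along a fast subsequence the increments are
  quasi-surely eventually geometric, by Borel-Cantelli.\<close>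

lemma L1_Cauchy_convergent_subseq:
  assumes X: "L1_Cauchy Xs"
  obtains r where "strict_mono r" "qs (\<lambda>\<omega>. convergent (\<lambda>k. Xs (r k) \<omega>))"
proof -
  have "\<forall>\<^sub>F n in sequentially. \<forall>m\<ge>n. e (\<lambda>\<omega>. \<bar>Xs m \<omega> - Xs n \<omega>\<bar>) \<le> (1/4) ^ k" for k
  proof -
    obtain N where "\<And>m n. N \<le> m \<Longrightarrow> N \<le> n \<Longrightarrow> e (\<lambda>\<omega>. \<bar>Xs m \<omega> - Xs n \<omega>\<bar>) < (1/4) ^ k"
      using L1_Cauchy_obtain[OF X, of "(1/4) ^ k"] by auto
    then show ?thesis unfolding eventually_sequentially
      by (meson order_trans less_imp_le)
  qed
  then obtain r where r: "strict_mono r"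
    "\<And>k. \<forall>n\<ge>r k. \<forall>m\<ge>n. e (\<lambda>\<omega>. \<bar>Xs m \<omega> - Xs n \<omega>\<bar>) \<le> (1/4) ^ k"
    by (rule strict_mono_choice[where P = "\<lambda>k n. \<forall>m\<ge>n. e (\<lambda>\<omega>. \<bar>Xs m \<omega> - Xs n \<omega>\<bar>) \<le> (1/4) ^ k"]) blast
  \<comment> \<open>Lets the tail estimate be used with \<open>n = r k\<close> and
    \<open>m = r (Suc k)\<close>, which bounds consecutive increments.\<close>
  have "r k \<le> r (Suc k)" for k
    using r(1) by (simp add: strict_mono_less_eq)
  then have "qs (\<lambda>\<omega>. \<forall>\<^sub>F k in sequentially. \<bar>Xs (r (Suc k)) \<omega> - Xs (r k) \<omega>\<bar> \<le> (1/2) ^ k)"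
    by (intro Borel_Cantelli_qs H_diff L1_CauchyD[OF X]) (use r(2) in blast)
  then have "qs (\<lambda>\<omega>. convergent (\<lambda>k. Xs (r k) \<omega>))"
    by (rule qs_mono) (rule convergent_of_geometric_increments)
  then show ?thesis using that r(1) by blast
qed

lemma norm_null_subseq:
  assumes V: "\<And>k. V k \<in> H" and lim: "(\<lambda>k. e (\<lambda>\<omega>. \<bar>V k \<omega>\<bar>)) \<longlonglongrightarrow> 0"
  obtains r where "strict_mono r" "qs (\<lambda>\<omega>. (\<lambda>k. V (r k) \<omega>) \<longlonglongrightarrow> 0)"
proof -
  have "\<forall>\<^sub>F n in sequentially. e (\<lambda>\<omega>. \<bar>V n \<omega>\<bar>) \<le> (1/4) ^ k" for k
    by (rule eventually_mono[OF order_tendstoD(2)[OF lim, of "(1/4) ^ k"]]) auto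
  then obtain r where r: "strict_mono r" "\<And>k. \<forall>n\<ge>r k. e (\<lambda>\<omega>. \<bar>V n \<omega>\<bar>) \<le> (1/4) ^ k"
    by (rule strict_mono_choice[where P = "\<lambda>k n. e (\<lambda>\<omega>. \<bar>V n \<omega>\<bar>) \<le> (1/4) ^ k"]) blast
  have "qs (\<lambda>\<omega>. \<forall>\<^sub>F k in sequentially. \<bar>V (r k) \<omega>\<bar> \<le> (1/2) ^ k)"
    by (intro Borel_Cantelli_qs V) (use r(2) in blast)
  then have "qs (\<lambda>\<omega>. (\<lambda>k. V (r k) \<omega>) \<longlonglongrightarrow> 0)"
  proof (rule qs_mono)
    fix \<omega> assume "\<forall>\<^sub>F k in sequentially. \<bar>V (r k) \<omega>\<bar> \<le> (1/2) ^ k"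
    then have "\<forall>\<^sub>F k in sequentially. norm (V (r k) \<omega>) \<le> (1/2) ^ k" by simp
    moreover have "(\<lambda>k. (1/2::real) ^ k) \<longlonglongrightarrow> 0" by (rule LIMSEQ_power_zero) simp
    ultimately show "(\<lambda>k. V (r k) \<omega>) \<longlonglongrightarrow> 0" by (rule Lim_null_comparison)
  qed
  then show ?thesis using that r(1) by blast
qed

text \<open>The extended-real limit must agree with the real limit that exists quasi-surely along a
  finer subsequence.\<close>

lemma conv_finite:
  assumes "conv Xs X" shows "qs (\<lambda>\<omega>. \<bar>X \<omega>\<bar> \<noteq> \<infinity>)"
proof -
  obtain p where p: "strict_mono p" "qs (\<lambda>\<omega>. (\<lambda>k. ereal (Xs (p k) \<omega>)) \<longlonglongrightarrow> X \<omega>)"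
    and X: "L1_Cauchy Xs"
    using assms by (auto simp: conv_iff)
  obtain r where r: "strict_mono r" "qs (\<lambda>\<omega>. convergent (\<lambda>k. Xs (p (r k)) \<omega>))"
    using L1_Cauchy_convergent_subseq[OF L1_Cauchy_subseq[OF X p(1)]] .
  show ?thesis
  proof (rule qs_mono2[OF p(2) r(2)])
    fix \<omega> assume a: "(\<lambda>k. ereal (Xs (p k) \<omega>)) \<longlonglongrightarrow> X \<omega>" "convergent (\<lambda>k. Xs (p (r k)) \<omega>)"
    then obtain l where "(\<lambda>k. Xs (p (r k)) \<omega>) \<longlonglongrightarrow> l" by (auto simp: convergent_def)
    then have "(\<lambda>k. ereal (Xs (p (r k)) \<omega>)) \<longlonglongrightarrow> ereal l" by simp
    moreover have "(\<lambda>k. ereal (Xs (p (r k)) \<omega>)) \<longlonglongrightarrow> X \<omega>"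
      using LIMSEQ_subseq_LIMSEQ[OF a(1) r(1)] by (simp add: o_def)
    ultimately have "X \<omega> = ereal l" by (rule LIMSEQ_unique[rotated])
    then show "\<bar>X \<omega>\<bar> \<noteq> \<infinity>" by simp
  qed
qed

text \<open>\<open>L1_conv\<close> provides only one good subsequence \<open>p\<close>. For an
  arbitrary \<open>q\<close>, the Cauchy property makes the norms of
  \<open>Xs (q k) - Xs (p k)\<close> tend to 0, so along a further subsequence the difference
  vanishes quasi-surely and the limit is inherited from \<open>p\<close>.\<close>

lemma conv_subseq:
  assumes "conv Xs X" "strict_mono (q :: nat \<Rightarrow> nat)"
  obtains u where "strict_mono u"
    "qs (\<lambda>\<omega>. \<bar>X \<omega>\<bar> \<noteq> \<infinity> \<and> (\<lambda>k. Xs (q (u k)) \<omega>) \<longlonglongrightarrow> real_of_ereal (X \<omega>))"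
proof -
  obtain p where p: "strict_mono p" "qs (\<lambda>\<omega>. (\<lambda>k. ereal (Xs (p k) \<omega>)) \<longlonglongrightarrow> X \<omega>)"
    and X: "L1_Cauchy Xs"
    using assms by (auto simp: conv_iff)
  have "(\<lambda>k. e (\<lambda>\<omega>. \<bar>Xs (q k) \<omega> - Xs (p k) \<omega>\<bar>)) \<longlonglongrightarrow> 0"
  proof (rule LIMSEQ_I)
    fix \<epsilon> :: real assume "0 < \<epsilon>"
    then obtain N where N: "\<And>m n. N \<le> m \<Longrightarrow> N \<le> n \<Longrightarrow> e (\<lambda>\<omega>. \<bar>Xs m \<omega> - Xs n \<omega>\<bar>) < \<epsilon>"
      using L1_Cauchy_obtain[OF X] by metis
    have "norm (e (\<lambda>\<omega>. \<bar>Xs (q k) \<omega> - Xs (p k) \<omega>\<bar>) - 0) < \<epsilon>" if "k \<ge> N" for k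
      using N[of "q k" "p k"] that seq_suble[OF assms(2), of k] seq_suble[OF p(1), of k]
        e_nonneg[OF H_abs[OF H_diff[OF L1_CauchyD[OF X, of "q k"] L1_CauchyD[OF X, of "p k"]]]]
      by simp
    then show "\<exists>N. \<forall>k\<ge>N. norm (e (\<lambda>\<omega>. \<bar>Xs (q k) \<omega> - Xs (p k) \<omega>\<bar>) - 0) < \<epsilon>" by blast
  qed
  from norm_null_subseq[OF H_diff[OF L1_CauchyD[OF X] L1_CauchyD[OF X]] this]
  obtain u where u: "strict_mono u" "qs (\<lambda>\<omega>. (\<lambda>k. Xs (q (u k)) \<omega> - Xs (p (u k)) \<omega>) \<longlonglongrightarrow> 0)" .
  have "qs (\<lambda>\<omega>. \<bar>X \<omega>\<bar> \<noteq> \<infinity> \<and> (\<lambda>k. Xs (q (u k)) \<omega>) \<longlonglongrightarrow> real_of_ereal (X \<omega>))"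
  proof (rule qs_mono3[OF p(2) u(2) conv_finite[OF assms(1)]])
    fix \<omega> assume a: "(\<lambda>k. ereal (Xs (p k) \<omega>)) \<longlonglongrightarrow> X \<omega>"
      "(\<lambda>k. Xs (q (u k)) \<omega> - Xs (p (u k)) \<omega>) \<longlonglongrightarrow> 0" "\<bar>X \<omega>\<bar> \<noteq> \<infinity>"
    obtain x where x: "X \<omega> = ereal x" using a(3) by auto
    have "(\<lambda>k. ereal (Xs (p (u k)) \<omega>)) \<longlonglongrightarrow> X \<omega>"
      using LIMSEQ_subseq_LIMSEQ[OF a(1) u(1)] by (simp add: o_def)
    then have "(\<lambda>k. Xs (p (u k)) \<omega>) \<longlonglongrightarrow> x" by (simp add: x)
    from tendsto_add[OF a(2) this]
    show "\<bar>X \<omega>\<bar> \<noteq> \<infinity> \<and> (\<lambda>k. Xs (q (u k)) \<omega>) \<longlonglongrightarrow> real_of_ereal (X \<omega>)"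
      by (simp add: x)
  qed
  then show ?thesis using that u(1) by blast
qed

text \<open>The two limits come with unrelated subsequences; one good for \<open>Xs\<close> is
  refined to be good for \<open>Ys\<close> as well.\<close>

lemma conv_common_subseq:
  assumes "conv Xs X" "conv Ys Y"
  obtains r where "strict_mono r"
    "qs (\<lambda>\<omega>. \<bar>X \<omega>\<bar> \<noteq> \<infinity> \<and> (\<lambda>k. Xs (r k) \<omega>) \<longlonglongrightarrow> real_of_ereal (X \<omega>))"
    "qs (\<lambda>\<omega>. \<bar>Y \<omega>\<bar> \<noteq> \<infinity> \<and> (\<lambda>k. Ys (r k) \<omega>) \<longlonglongrightarrow> real_of_ereal (Y \<omega>))"
proof -
  obtain p where p: "strict_mono p"
    "qs (\<lambda>\<omega>. \<bar>X \<omega>\<bar> \<noteq> \<infinity> \<and> (\<lambda>k. Xs (p k) \<omega>) \<longlonglongrightarrow> real_of_ereal (X \<omega>))"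
    using conv_subseq[OF assms(1) strict_mono_id] by (auto simp: id_def)
  obtain u where u: "strict_mono u"
    "qs (\<lambda>\<omega>. \<bar>Y \<omega>\<bar> \<noteq> \<infinity> \<and> (\<lambda>k. Ys (p (u k)) \<omega>) \<longlonglongrightarrow> real_of_ereal (Y \<omega>))"
    using conv_subseq[OF assms(2) p(1)] .
  have "strict_mono (\<lambda>k. p (u k))"
    using strict_mono_o[OF p(1) u(1)] by (simp add: o_def)
  moreover have "qs (\<lambda>\<omega>. \<bar>X \<omega>\<bar> \<noteq> \<infinity> \<and> (\<lambda>k. Xs (p (u k)) \<omega>) \<longlonglongrightarrow> real_of_ereal (X \<omega>))"
  proof (rule qs_mono[OF p(2)])
    fix \<omega> assume a: "\<bar>X \<omega>\<bar> \<noteq> \<infinity> \<and> (\<lambda>k. Xs (p k) \<omega>) \<longlonglongrightarrow> real_of_ereal (X \<omega>)"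
    then show "\<bar>X \<omega>\<bar> \<noteq> \<infinity> \<and> (\<lambda>k. Xs (p (u k)) \<omega>) \<longlonglongrightarrow> real_of_ereal (X \<omega>)"
      using LIMSEQ_subseq_LIMSEQ[OF conjunct2[OF a] u(1)] by (simp add: o_def)
  qed
  ultimately show ?thesis using that u(2) by blast
qed

text \<open>
  The limit function determines the class: along a common subsequence \<open>r\<close> the difference
  \<open>Xs n - Ys n\<close> is the quasi-sure limit of \<open>(Xs n - Ys n) - (Xs (r k) - Ys (r k))\<close>, whose norms
  are small by the Cauchy property, so Fatou's lemma applies.
\<close>

lemma conv_unique:
  assumes X: "conv Xs X" and Y: "conv Ys Y" and eq: "qs (\<lambda>\<omega>. X \<omega> = Y \<omega>)"
  shows "(\<lambda>n. e (\<lambda>\<omega>. \<bar>Xs n \<omega> - Ys n \<omega>\<bar>)) \<longlonglongrightarrow> 0"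
proof (rule LIMSEQ_I)
  fix \<epsilon> :: real assume \<epsilon>: "0 < \<epsilon>"
  have CX: "L1_Cauchy Xs" and CY: "L1_Cauchy Ys" using X Y by (auto simp: conv_iff)
  note HX = L1_CauchyD[OF CX] and HY = L1_CauchyD[OF CY]
  obtain r where r: "strict_mono r"
    "qs (\<lambda>\<omega>. \<bar>X \<omega>\<bar> \<noteq> \<infinity> \<and> (\<lambda>k. Xs (r k) \<omega>) \<longlonglongrightarrow> real_of_ereal (X \<omega>))"
    "qs (\<lambda>\<omega>. \<bar>Y \<omega>\<bar> \<noteq> \<infinity> \<and> (\<lambda>k. Ys (r k) \<omega>) \<longlonglongrightarrow> real_of_ereal (Y \<omega>))"
    using conv_common_subseq[OF X Y] .
  obtain N1 where N1: "\<And>m n. N1 \<le> m \<Longrightarrow> N1 \<le> n \<Longrightarrow> e (\<lambda>\<omega>. \<bar>Xs m \<omega> - Xs n \<omega>\<bar>) < \<epsilon>/3"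
    using L1_Cauchy_obtain[OF CX, of "\<epsilon>/3"] \<epsilon> by auto
  obtain N2 where N2: "\<And>m n. N2 \<le> m \<Longrightarrow> N2 \<le> n \<Longrightarrow> e (\<lambda>\<omega>. \<bar>Ys m \<omega> - Ys n \<omega>\<bar>) < \<epsilon>/3"
    using L1_Cauchy_obtain[OF CY, of "\<epsilon>/3"] \<epsilon> by auto
  \<comment> \<open>Fatou's lemma gives only a non-strict bound; two tolerances of
    \<open>\<epsilon>/3\<close> leave room for the strict bound by \<epsilon>.\<close>
  have "e (\<lambda>\<omega>. \<bar>Xs n \<omega> - Ys n \<omega>\<bar>) \<le> 2 * \<epsilon> / 3" if n: "n \<ge> max N1 N2" for n
  proof (rule e_Fatou[where Ys = "\<lambda>k \<omega>. \<bar>(Xs n \<omega> - Ys n \<omega>) - (Xs (r k) \<omega> - Ys (r k) \<omega>)\<bar>"])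
    show "qs (\<lambda>\<omega>. (\<lambda>k. \<bar>(Xs n \<omega> - Ys n \<omega>) - (Xs (r k) \<omega> - Ys (r k) \<omega>)\<bar>) \<longlonglongrightarrow> \<bar>Xs n \<omega> - Ys n \<omega>\<bar>)"
    proof (rule qs_mono3[OF r(2,3) eq])
      fix \<omega> assume a: "\<bar>X \<omega>\<bar> \<noteq> \<infinity> \<and> (\<lambda>k. Xs (r k) \<omega>) \<longlonglongrightarrow> real_of_ereal (X \<omega>)"
        "\<bar>Y \<omega>\<bar> \<noteq> \<infinity> \<and> (\<lambda>k. Ys (r k) \<omega>) \<longlonglongrightarrow> real_of_ereal (Y \<omega>)" "X \<omega> = Y \<omega>"
      have "(\<lambda>k. \<bar>(Xs n \<omega> - Ys n \<omega>) - (Xs (r k) \<omega> - Ys (r k) \<omega>)\<bar>)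
          \<longlonglongrightarrow> \<bar>(Xs n \<omega> - Ys n \<omega>) - (real_of_ereal (X \<omega>) - real_of_ereal (Y \<omega>))\<bar>"
        using a by (intro tendsto_intros) auto
      then show "(\<lambda>k. \<bar>(Xs n \<omega> - Ys n \<omega>) - (Xs (r k) \<omega> - Ys (r k) \<omega>)\<bar>) \<longlonglongrightarrow> \<bar>Xs n \<omega> - Ys n \<omega>\<bar>"
        using a(3) by simp
    qed
    have "e (\<lambda>\<omega>. \<bar>(Xs n \<omega> - Ys n \<omega>) - (Xs (r k) \<omega> - Ys (r k) \<omega>)\<bar>) \<le> 2 * \<epsilon> / 3" if k: "k \<ge> max N1 N2" for k
    proof -
      have "e (\<lambda>\<omega>. \<bar>(Xs n \<omega> - Ys n \<omega>) - (Xs (r k) \<omega> - Ys (r k) \<omega>)\<bar>)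
          \<le> e (\<lambda>\<omega>. \<bar>Xs n \<omega> - Xs (r k) \<omega>\<bar> + \<bar>Ys n \<omega> - Ys (r k) \<omega>\<bar>)"
        by (intro e_mono H_add H_abs H_diff HX HY) auto
      also have "\<dots> \<le> e (\<lambda>\<omega>. \<bar>Xs n \<omega> - Xs (r k) \<omega>\<bar>) + e (\<lambda>\<omega>. \<bar>Ys n \<omega> - Ys (r k) \<omega>\<bar>)"
        by (intro e_add H_abs H_diff HX HY)
      also have "\<dots> \<le> \<epsilon>/3 + \<epsilon>/3"
        using n k seq_suble[OF r(1), of k] by (intro add_mono less_imp_le[OF N1] less_imp_le[OF N2]) auto
      finally show ?thesis by simp
    qed
    then show "\<forall>\<^sub>F k in sequentially.
        e (\<lambda>\<omega>. \<bar>(Xs n \<omega> - Ys n \<omega>) - (Xs (r k) \<omega> - Ys (r k) \<omega>)\<bar>) \<le> 2 * \<epsilon> / 3"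
      unfolding eventually_sequentially by blast
  qed (auto intro!: H_abs H_diff HX HY)
  then have "norm (e (\<lambda>\<omega>. \<bar>Xs n \<omega> - Ys n \<omega>\<bar>) - 0) < \<epsilon>" if "n \<ge> max N1 N2" for n
    using that \<epsilon> e_nonneg[OF H_abs[OF H_diff[OF HX[of n] HY[of n]]]] by force
  then show "\<exists>N. \<forall>n\<ge>N. norm (e (\<lambda>\<omega>. \<bar>Xs n \<omega> - Ys n \<omega>\<bar>) - 0) < \<epsilon>" by blast
qed

section \<open>Equivalent sequences, comparison and combination of limits\<close>

text \<open>Triangle inequality through \<open>Xs m\<close> and \<open>Xs n\<close>, each of the
  three legs costing \<open>\<epsilon>/3\<close>.\<close>

lemma L1_Cauchy_close:
  assumes X: "L1_Cauchy Xs" and HY: "\<And>n. Ys n \<in> H"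
    and lim: "(\<lambda>n. e (\<lambda>\<omega>. \<bar>Xs n \<omega> - Ys n \<omega>\<bar>)) \<longlonglongrightarrow> 0"
  shows "L1_Cauchy Ys"
proof (rule L1_CauchyI)
  fix \<epsilon> :: real assume \<epsilon>: "0 < \<epsilon>"
  note HX = L1_CauchyD[OF X]
  obtain N1 where N1: "\<And>m n. N1 \<le> m \<Longrightarrow> N1 \<le> n \<Longrightarrow> e (\<lambda>\<omega>. \<bar>Xs m \<omega> - Xs n \<omega>\<bar>) < \<epsilon>/3"
    using L1_Cauchy_obtain[OF X, of "\<epsilon>/3"] \<epsilon> by auto
  obtain N2 where N2: "\<And>n. N2 \<le> n \<Longrightarrow> e (\<lambda>\<omega>. \<bar>Xs n \<omega> - Ys n \<omega>\<bar>) < \<epsilon>/3"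
    using order_tendstoD(2)[OF lim, of "\<epsilon>/3"] \<epsilon> by (auto simp: eventually_sequentially)
  have "e (\<lambda>\<omega>. \<bar>Ys m \<omega> - Ys n \<omega>\<bar>) < \<epsilon>" if "m \<ge> max N1 N2" "n \<ge> max N1 N2" for m n
    using e_abs_diff_triangle[OF HY[of m] HX[of m] HY[of n]] e_abs_diff_triangle[OF HX[of m] HX[of n] HY[of n]]
      N1[of m n] N2[of m] N2[of n] that by (simp add: abs_minus_commute)
  then show "\<exists>N. \<forall>m\<ge>N. \<forall>n\<ge>N. e (\<lambda>\<omega>. \<bar>Ys m \<omega> - Ys n \<omega>\<bar>) < \<epsilon>" by blast
qed (rule HY)

text \<open>Converse direction to \<open>conv_unique\<close>: equivalent sequences share their limit
  function. Quasi-sure finiteness of \<open>X\<close> reduces the passage to the limit to real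
  arithmetic.\<close>

lemma conv_close:
  assumes X: "conv Xs X" and HY: "\<And>n. Ys n \<in> H"
    and lim: "(\<lambda>n. e (\<lambda>\<omega>. \<bar>Xs n \<omega> - Ys n \<omega>\<bar>)) \<longlonglongrightarrow> 0"
  shows "conv Ys X"
proof -
  obtain p where p: "strict_mono p" "qs (\<lambda>\<omega>. (\<lambda>k. ereal (Xs (p k) \<omega>)) \<longlonglongrightarrow> X \<omega>)"
    and CX: "L1_Cauchy Xs" and mX: "X \<in> borel_measurable G"
    using X by (auto simp: conv_iff)
  note HX = L1_CauchyD[OF CX]
  have "(\<lambda>k. e (\<lambda>\<omega>. \<bar>Xs (p k) \<omega> - Ys (p k) \<omega>\<bar>)) \<longlonglongrightarrow> 0"
    using LIMSEQ_subseq_LIMSEQ[OF lim p(1)] by (simp add: o_def)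
  from norm_null_subseq[OF H_diff[OF HX HY] this]
  obtain u where u: "strict_mono u"
    "qs (\<lambda>\<omega>. (\<lambda>k. Xs (p (u k)) \<omega> - Ys (p (u k)) \<omega>) \<longlonglongrightarrow> 0)" .
  have "qs (\<lambda>\<omega>. (\<lambda>k. ereal (Ys (p (u k)) \<omega>)) \<longlonglongrightarrow> X \<omega>)"
  proof (rule qs_mono3[OF p(2) u(2) conv_finite[OF X]])
    fix \<omega> assume a: "(\<lambda>k. ereal (Xs (p k) \<omega>)) \<longlonglongrightarrow> X \<omega>"
      "(\<lambda>k. Xs (p (u k)) \<omega> - Ys (p (u k)) \<omega>) \<longlonglongrightarrow> 0" "\<bar>X \<omega>\<bar> \<noteq> \<infinity>"
    obtain x where x: "X \<omega> = ereal x" using a(3) by auto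
    have "(\<lambda>k. ereal (Xs (p (u k)) \<omega>)) \<longlonglongrightarrow> X \<omega>"
      using LIMSEQ_subseq_LIMSEQ[OF a(1) u(1)] by (simp add: o_def)
    then have "(\<lambda>k. Xs (p (u k)) \<omega>) \<longlonglongrightarrow> x" by (simp add: x)
    from tendsto_diff[OF this a(2)]
    show "(\<lambda>k. ereal (Ys (p (u k)) \<omega>)) \<longlonglongrightarrow> X \<omega>" by (simp add: x)
  qed
  moreover have "strict_mono (\<lambda>k. p (u k))"
    using strict_mono_o[OF p(1) u(1)] by (simp add: o_def)
  ultimately show ?thesis
    using L1_Cauchy_close[OF CX HY lim] mX unfolding conv_iff
    by (intro conjI exI[of _ "\<lambda>k. p (u k)"]) auto
qed

lemma conv_le_on:
  assumes X: "conv Xs X" and Y: "conv Ys Y"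
    and le: "\<And>n \<omega>. \<omega> \<in> \<Omega> \<Longrightarrow> \<omega> \<in> A \<Longrightarrow> Xs n \<omega> \<le> Ys n \<omega>"
  shows "qs (\<lambda>\<omega>. \<omega> \<in> A \<longrightarrow> X \<omega> \<le> Y \<omega>)"
proof -
  obtain r where r: "strict_mono r"
    "qs (\<lambda>\<omega>. \<bar>X \<omega>\<bar> \<noteq> \<infinity> \<and> (\<lambda>k. Xs (r k) \<omega>) \<longlonglongrightarrow> real_of_ereal (X \<omega>))"
    "qs (\<lambda>\<omega>. \<bar>Y \<omega>\<bar> \<noteq> \<infinity> \<and> (\<lambda>k. Ys (r k) \<omega>) \<longlonglongrightarrow> real_of_ereal (Y \<omega>))"
    using conv_common_subseq[OF X Y] .
  show ?thesis
  proof (rule qs_mono2[OF r(2,3)], rule impI)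
    fix \<omega> assume \<omega>: "\<omega> \<in> \<Omega>" "\<omega> \<in> A"
      and a: "\<bar>X \<omega>\<bar> \<noteq> \<infinity> \<and> (\<lambda>k. Xs (r k) \<omega>) \<longlonglongrightarrow> real_of_ereal (X \<omega>)"
        "\<bar>Y \<omega>\<bar> \<noteq> \<infinity> \<and> (\<lambda>k. Ys (r k) \<omega>) \<longlonglongrightarrow> real_of_ereal (Y \<omega>)"
    have "real_of_ereal (X \<omega>) \<le> real_of_ereal (Y \<omega>)"
      by (rule LIMSEQ_le[OF conjunct2[OF a(1)] conjunct2[OF a(2)]]) (use le \<omega> in blast)
    then show "X \<omega> \<le> Y \<omega>" using a by (cases "X \<omega>"; cases "Y \<omega>") auto
  qed
qed

text \<open>A common tool for sequences built pointwise from \<open>Xs\<close> and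
  \<open>Ys\<close>: the Lipschitz bound transfers the Cauchy property, and \<open>lim\<close>
  identifies the limit along a common subsequence. The predicate \<open>Q\<close> carries quasi-sure
  information relating \<open>X\<close> and \<open>Y\<close>.\<close>

lemma conv_combine:
  assumes X: "conv Xs X" and Y: "conv Ys Y"
    and HZ: "\<And>n. Zs n \<in> H" and mZ: "Z \<in> borel_measurable G"
    and lip: "\<And>m n \<omega>. \<omega> \<in> \<Omega> \<Longrightarrow>
      \<bar>Zs m \<omega> - Zs n \<omega>\<bar> \<le> 2 * \<bar>Xs m \<omega> - Xs n \<omega>\<bar> + 2 * \<bar>Ys m \<omega> - Ys n \<omega>\<bar>"
    and Q: "qs Q"
    and lim: "\<And>\<omega> r x y. \<omega> \<in> \<Omega> \<Longrightarrow> Q \<omega> \<Longrightarrow> X \<omega> = ereal x \<Longrightarrow> Y \<omega> = ereal y \<Longrightarrow>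
      (\<lambda>k. Xs (r k) \<omega>) \<longlonglongrightarrow> x \<Longrightarrow> (\<lambda>k. Ys (r k) \<omega>) \<longlonglongrightarrow> y \<Longrightarrow>
      (\<lambda>k. ereal (Zs (r k) \<omega>)) \<longlonglongrightarrow> Z \<omega>"
  shows "conv Zs Z"
proof -
  have CX: "L1_Cauchy Xs" and CY: "L1_Cauchy Ys" using X Y by (auto simp: conv_iff)
  note HX = L1_CauchyD[OF CX] and HY = L1_CauchyD[OF CY]
  have "L1_Cauchy Zs"
  proof (rule L1_CauchyI[OF HZ])
    fix \<epsilon> :: real assume \<epsilon>: "0 < \<epsilon>"
    obtain N1 where N1: "\<And>m n. N1 \<le> m \<Longrightarrow> N1 \<le> n \<Longrightarrow> e (\<lambda>\<omega>. \<bar>Xs m \<omega> - Xs n \<omega>\<bar>) < \<epsilon>/4"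
      using L1_Cauchy_obtain[OF CX, of "\<epsilon>/4"] \<epsilon> by auto
    obtain N2 where N2: "\<And>m n. N2 \<le> m \<Longrightarrow> N2 \<le> n \<Longrightarrow> e (\<lambda>\<omega>. \<bar>Ys m \<omega> - Ys n \<omega>\<bar>) < \<epsilon>/4"
      using L1_Cauchy_obtain[OF CY, of "\<epsilon>/4"] \<epsilon> by auto
    have "e (\<lambda>\<omega>. \<bar>Zs m \<omega> - Zs n \<omega>\<bar>) < \<epsilon>" if mn: "m \<ge> max N1 N2" "n \<ge> max N1 N2" for m n
    proof -
      have hx: "(\<lambda>\<omega>. \<bar>Xs m \<omega> - Xs n \<omega>\<bar>) \<in> H" and hy: "(\<lambda>\<omega>. \<bar>Ys m \<omega> - Ys n \<omega>\<bar>) \<in> H"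
        by (intro H_abs H_diff HX HY)+
      have "e (\<lambda>\<omega>. \<bar>Zs m \<omega> - Zs n \<omega>\<bar>)
          \<le> e (\<lambda>\<omega>. 2 * \<bar>Xs m \<omega> - Xs n \<omega>\<bar> + 2 * \<bar>Ys m \<omega> - Ys n \<omega>\<bar>)"
        by (intro e_mono lip H_add H_scale hx hy H_abs H_diff HZ)
      also have "\<dots> \<le> e (\<lambda>\<omega>. 2 * \<bar>Xs m \<omega> - Xs n \<omega>\<bar>) + e (\<lambda>\<omega>. 2 * \<bar>Ys m \<omega> - Ys n \<omega>\<bar>)"
        by (intro e_add H_scale hx hy)
      also have "\<dots> = 2 * e (\<lambda>\<omega>. \<bar>Xs m \<omega> - Xs n \<omega>\<bar>) + 2 * e (\<lambda>\<omega>. \<bar>Ys m \<omega> - Ys n \<omega>\<bar>)"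
        using e_scale[OF hx, of 2] e_scale[OF hy, of 2] by simp
      also have "\<dots> < \<epsilon>" using N1[of m n] N2[of m n] mn by simp
      finally show ?thesis .
    qed
    then show "\<exists>N. \<forall>m\<ge>N. \<forall>n\<ge>N. e (\<lambda>\<omega>. \<bar>Zs m \<omega> - Zs n \<omega>\<bar>) < \<epsilon>" by blast
  qed
  moreover obtain r where r: "strict_mono r"
    "qs (\<lambda>\<omega>. \<bar>X \<omega>\<bar> \<noteq> \<infinity> \<and> (\<lambda>k. Xs (r k) \<omega>) \<longlonglongrightarrow> real_of_ereal (X \<omega>))"
    "qs (\<lambda>\<omega>. \<bar>Y \<omega>\<bar> \<noteq> \<infinity> \<and> (\<lambda>k. Ys (r k) \<omega>) \<longlonglongrightarrow> real_of_ereal (Y \<omega>))"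
    using conv_common_subseq[OF X Y] .
  moreover have "qs (\<lambda>\<omega>. (\<lambda>k. ereal (Zs (r k) \<omega>)) \<longlonglongrightarrow> Z \<omega>)"
  proof (rule qs_mono3[OF r(2,3) Q])
    fix \<omega> assume \<omega>: "\<omega> \<in> \<Omega>" "Q \<omega>"
      and a: "\<bar>X \<omega>\<bar> \<noteq> \<infinity> \<and> (\<lambda>k. Xs (r k) \<omega>) \<longlonglongrightarrow> real_of_ereal (X \<omega>)"
        "\<bar>Y \<omega>\<bar> \<noteq> \<infinity> \<and> (\<lambda>k. Ys (r k) \<omega>) \<longlonglongrightarrow> real_of_ereal (Y \<omega>)"
    then show "(\<lambda>k. ereal (Zs (r k) \<omega>)) \<longlonglongrightarrow> Z \<omega>"
      by (intro lim[of \<omega> "real_of_ereal (X \<omega>)" "real_of_ereal (Y \<omega>)" r])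
         (auto simp: ereal_real)
  qed
  ultimately show ?thesis using mZ unfolding conv_iff by blast
qed

subsection \<open>The extended conditional expectations\<close>

text \<open>Monotonicity and subadditivity bound the difference of \<open>E t X\<close> and
  \<open>E t Y\<close>, in either order, by \<open>E t\<close> of the absolute difference; the tower
  property at time 0 then removes \<open>E t\<close>.\<close>

lemma E_contraction:
  assumes "X \<in> H" "Y \<in> H"
  shows "e (\<lambda>\<omega>. \<bar>E t X \<omega> - E t Y \<omega>\<bar>) \<le> e (\<lambda>\<omega>. \<bar>X \<omega> - Y \<omega>\<bar>)"
proof -
  have le: "E t X \<omega> \<le> E t (\<lambda>\<omega>. \<bar>X \<omega> - Y \<omega>\<bar>) \<omega> + E t Y \<omega>"
    if "X \<in> H" "Y \<in> H" "\<omega> \<in> \<Omega>" for X Y \<omega>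
  proof -
    have "E t X \<omega> \<le> E t (\<lambda>\<omega>. \<bar>X \<omega> - Y \<omega>\<bar> + Y \<omega>) \<omega>"
      by (intro E_mono H_add H_abs H_diff that) auto
    also have "\<dots> \<le> E t (\<lambda>\<omega>. \<bar>X \<omega> - Y \<omega>\<bar>) \<omega> + E t Y \<omega>"
      by (intro E_subadd H_abs H_diff that)
    finally show ?thesis .
  qed
  have "e (\<lambda>\<omega>. \<bar>E t X \<omega> - E t Y \<omega>\<bar>) \<le> e (E t (\<lambda>\<omega>. \<bar>X \<omega> - Y \<omega>\<bar>))"
  proof (intro e_mono H_abs H_diff E_H assms)
    fix \<omega> assume "\<omega> \<in> \<Omega>"
    then show "\<bar>E t X \<omega> - E t Y \<omega>\<bar> \<le> E t (\<lambda>\<omega>. \<bar>X \<omega> - Y \<omega>\<bar>) \<omega>"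
      using le[OF assms, of \<omega>] le[OF assms(2,1), of \<omega>] by (simp add: abs_minus_commute abs_le_iff)
  qed
  also have "\<dots> = e (\<lambda>\<omega>. \<bar>X \<omega> - Y \<omega>\<bar>)"
    by (intro e_tower H_abs H_diff assms)
  finally show ?thesis .
qed

lemma L1_Cauchy_E:
  assumes "L1_Cauchy Xs" shows "L1_Cauchy (\<lambda>n. E t (Xs n))"
proof (rule L1_CauchyI)
  fix \<epsilon> :: real assume "0 < \<epsilon>"
  then obtain N where "\<And>m n. N \<le> m \<Longrightarrow> N \<le> n \<Longrightarrow> e (\<lambda>\<omega>. \<bar>Xs m \<omega> - Xs n \<omega>\<bar>) < \<epsilon>"
    using L1_Cauchy_obtain[OF assms] by metis
  then show "\<exists>N. \<forall>m\<ge>N. \<forall>n\<ge>N. e (\<lambda>\<omega>. \<bar>E t (Xs m) \<omega> - E t (Xs n) \<omega>\<bar>) < \<epsilon>"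
    using E_contraction[OF L1_CauchyD[OF assms] L1_CauchyD[OF assms]] by (meson order.strict_trans1)
qed (use assms L1_CauchyD E_H in auto)

text \<open>Supplies the witness for the choice in \<open>E_ext\<close>. The limit superior along a
  good subsequence is defined everywhere and \<open>F t\<close>-measurable, and it equals the limit
  wherever that exists.\<close>

lemma conv_E_exists:
  assumes "L1_Cauchy Xs"
  shows "\<exists>Y. Y \<in> borel_measurable (F t) \<and> conv (\<lambda>n. E t (Xs n)) Y"
proof -
  note C = L1_Cauchy_E[OF assms, of t]
  obtain r where r: "strict_mono r" "qs (\<lambda>\<omega>. convergent (\<lambda>k. E t (Xs (r k)) \<omega>))"
    using L1_Cauchy_convergent_subseq[OF C] .
  have [measurable]: "E t (Xs n) \<in> borel_measurable (F t)" for n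
    using E_in[OF L1_CauchyD[OF assms]] by (simp add: H_at_def)
  define Y where "Y \<omega> = limsup (\<lambda>k. ereal (E t (Xs (r k)) \<omega>))" for \<omega>
  have Y: "Y \<in> borel_measurable (F t)" unfolding Y_def by measurable
  have "qs (\<lambda>\<omega>. (\<lambda>k. ereal (E t (Xs (r k)) \<omega>)) \<longlonglongrightarrow> Y \<omega>)"
  proof (rule qs_mono[OF r(2)])
    fix \<omega> assume "convergent (\<lambda>k. E t (Xs (r k)) \<omega>)"
    then obtain l where "(\<lambda>k. E t (Xs (r k)) \<omega>) \<longlonglongrightarrow> l" by (auto simp: convergent_def)
    then have l: "(\<lambda>k. ereal (E t (Xs (r k)) \<omega>)) \<longlonglongrightarrow> ereal l" by simp
    then have "Y \<omega> = ereal l" unfolding Y_def by (intro lim_imp_Limsup) auto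
    then show "(\<lambda>k. ereal (E t (Xs (r k)) \<omega>)) \<longlonglongrightarrow> Y \<omega>" using l by simp
  qed
  then show ?thesis
    using Y C r(1) borel_F_imp_G unfolding conv_iff by blast
qed

text \<open>The choice in \<open>E_ext\<close> comes with some approximating sequence of its own. By
  \<open>conv_unique\<close> any other one is equivalent to it, and the contraction property carries
  the equivalence over to the images, so the extension can be computed from every
  approximation.\<close>

lemma conv_ext:
  assumes X: "conv Xs X"
  shows "conv (\<lambda>n. E t (Xs n)) (ext t X)"
proof -
  have "\<exists>Y. Y \<in> borel_measurable (F t) \<and> (\<exists>Xs. conv Xs X \<and> conv (\<lambda>n. E t (Xs n)) Y)"
    using conv_E_exists[of Xs t] X by (auto simp: conv_iff)
  from someI_ex[OF this] obtain Xs'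
    where X': "conv Xs' X" "conv (\<lambda>n. E t (Xs' n)) (ext t X)"
    unfolding E_ext_def by blast
  have HX: "Xs n \<in> H" "Xs' n \<in> H" for n
    using X X' L1_CauchyD by (auto simp: conv_iff)
  have "(\<lambda>n. e (\<lambda>\<omega>. \<bar>Xs' n \<omega> - Xs n \<omega>\<bar>)) \<longlonglongrightarrow> 0"
    by (intro conv_unique[OF X'(1) X] qs_I) simp
  then have "(\<lambda>n. e (\<lambda>\<omega>. \<bar>E t (Xs' n) \<omega> - E t (Xs n) \<omega>\<bar>)) \<longlonglongrightarrow> 0"
    by (rule tendsto_sandwich[OF always_eventually always_eventually tendsto_const, rotated 2])
       (auto intro!: e_nonneg H_abs H_diff E_H HX E_contraction)
  then show ?thesis
    by (intro conv_close[OF X'(2)] E_H HX)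
qed

text \<open>Monotonicity localised to an event of \<open>F t\<close>. An inequality between limits
  need not hold between the approximations, so \<open>Ys\<close> is replaced by \<open>Zs\<close>,
  which is the maximum of \<open>Xs\<close> and \<open>Ys\<close> on \<open>A\<close> and
  \<open>Ys\<close> elsewhere.\<close>

lemma ext_mono_on:
  assumes X: "conv Xs X" and Y: "conv Ys Y" and A: "A \<in> sets (F t)"
    and le: "qs (\<lambda>\<omega>. \<omega> \<in> A \<longrightarrow> X \<omega> \<le> Y \<omega>)"
  shows "qs (\<lambda>\<omega>. \<omega> \<in> A \<longrightarrow> ext t X \<omega> \<le> ext t Y \<omega>)"
proof -
  define Zs where "Zs n \<omega> = Ys n \<omega> + indicat_real A \<omega> * max (Xs n \<omega> - Ys n \<omega>) 0" for n \<omega>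
  have AG: "A \<in> sets G" using A sets_F_subset_G by auto
  have HX: "Xs n \<in> H" "Ys n \<in> H" for n
    using X Y L1_CauchyD by (auto simp: conv_iff)
  have HZ: "Zs n \<in> H" for n
    unfolding Zs_def by (intro H_add H_indicator H_max H_diff H_const HX AG)
  have Z: "conv Zs Y"
  proof (rule conv_combine[OF X Y HZ _ _ le])
    show "\<bar>Zs m \<omega> - Zs n \<omega>\<bar> \<le> 2 * \<bar>Xs m \<omega> - Xs n \<omega>\<bar> + 2 * \<bar>Ys m \<omega> - Ys n \<omega>\<bar>" for m n \<omega>
    proof (cases "\<omega> \<in> A")
      case True
      then have "Zs k \<omega> = max (Xs k \<omega>) (Ys k \<omega>)" for k by (simp add: Zs_def max_def)
      then show ?thesis by (simp add: max_def abs_if)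
    qed (simp add: Zs_def)
    fix \<omega> r x y assume a: "\<omega> \<in> A \<longrightarrow> X \<omega> \<le> Y \<omega>" "X \<omega> = ereal x" "Y \<omega> = ereal y"
      "(\<lambda>k. Xs (r k) \<omega>) \<longlonglongrightarrow> x" "(\<lambda>k. Ys (r k) \<omega>) \<longlonglongrightarrow> y"
    have "(\<lambda>k. Zs (r k) \<omega>) \<longlonglongrightarrow> y + indicat_real A \<omega> * max (x - y) 0"
      unfolding Zs_def by (intro tendsto_intros a)
    \<comment> \<open>On \<open>A\<close> the hypothesis gives \<open>x \<le> y\<close>, and off
      \<open>A\<close> the indicator is 0; so the correction does not change the limit.\<close>
    also have "y + indicat_real A \<omega> * max (x - y) 0 = y"
      using a by (auto simp: indicator_def)
    finally show "(\<lambda>k. ereal (Zs (r k) \<omega>)) \<longlonglongrightarrow> Y \<omega>" using a by simp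
  qed (use Y in \<open>simp add: conv_iff\<close>)
  show ?thesis
  proof (rule conv_le_on[OF conv_ext[OF X] conv_ext[OF Z]])
    fix n \<omega> assume \<omega>: "\<omega> \<in> \<Omega>" "\<omega> \<in> A"
    \<comment> \<open>\<open>Xs n \<le> Zs n\<close> is used only on \<open>A\<close>; multiplying
      both by the indicator and removing it again by locality confines the comparison to
      \<open>A\<close>.\<close>
    have "E t (Xs n) \<omega> = E t (\<lambda>x. indicat_real A x * Xs n x) \<omega>"
      using E_local[OF HX(1) A \<omega>(1)] \<omega> by simp
    also have "\<dots> \<le> E t (\<lambda>x. indicat_real A x * Zs n x) \<omega>"
      by (intro E_mono H_indicator AG HX HZ \<omega>) (auto simp: Zs_def indicator_def)
    also have "\<dots> = E t (Zs n) \<omega>"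
      using E_local[OF HZ A \<omega>(1)] \<omega> by simp
    finally show "E t (Xs n) \<omega> \<le> E t (Zs n) \<omega>" .
  qed
qed

text \<open>Both sides are limits of the same values, since \<open>E s (E t (Xs n))\<close> and
  \<open>E s (Xs n)\<close> agree on \<Omega>.\<close>

lemma ext_tower_le:
  assumes X: "conv Xs X" and "s \<le> t"
  shows "qs (\<lambda>\<omega>. ext s (ext t X) \<omega> \<le> ext s X \<omega>)"
proof -
  have "Xs n \<in> H" for n using X L1_CauchyD by (auto simp: conv_iff)
  then have "qs (\<lambda>\<omega>. \<omega> \<in> UNIV \<longrightarrow> ext s (ext t X) \<omega> \<le> ext s X \<omega>)"
    using E_tower[OF _ assms(2)]
    by (intro conv_le_on[OF conv_ext[OF conv_ext[OF X]] conv_ext[OF X]]) simp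
  then show ?thesis by simp
qed

subsection \<open>Stopped processes\<close>

lemma stopping_set: "stopping_time F T \<Longrightarrow> {\<omega> \<in> \<Omega>. T \<omega> \<le> t} \<in> sets (F t)"
  unfolding stopping_time_def by (metis (no_types) pred_def space_F)

text \<open>Approximations are glued along \<open>A\<close> in the same way as their limits.\<close>

lemma L1_if:
  assumes "X \<in> L1 \<Omega> F H E" "Y \<in> L1 \<Omega> F H E" and A: "A \<in> sets G"
  shows "(\<lambda>\<omega>. if \<omega> \<in> A then X \<omega> else Y \<omega>) \<in> L1 \<Omega> F H E"
proof -
  obtain Xs Ys where X: "conv Xs X" and Y: "conv Ys Y" using assms by (auto simp: L1_def)
  define Zs where "Zs n \<omega> = Ys n \<omega> + indicat_real A \<omega> * (Xs n \<omega> - Ys n \<omega>)" for n \<omega>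
  have HX: "Xs n \<in> H" "Ys n \<in> H" for n
    using X Y L1_CauchyD by (auto simp: conv_iff)
  have "conv Zs (\<lambda>\<omega>. if \<omega> \<in> A then X \<omega> else Y \<omega>)"
  proof (rule conv_combine[OF X Y, where Q = "\<lambda>_. True"])
    show "Zs n \<in> H" for n
      unfolding Zs_def by (intro H_add H_indicator H_diff HX A)
    show "(\<lambda>\<omega>. if \<omega> \<in> A then X \<omega> else Y \<omega>) \<in> borel_measurable G"
      using X Y A by (intro measurable_If_set) (simp_all add: conv_iff sets.Int_space_eq2 del: space_G)
    show "\<bar>Zs m \<omega> - Zs n \<omega>\<bar> \<le> 2 * \<bar>Xs m \<omega> - Xs n \<omega>\<bar> + 2 * \<bar>Ys m \<omega> - Ys n \<omega>\<bar>" for m n \<omega>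
      by (auto simp: Zs_def indicator_def)
    show "(\<lambda>k. ereal (Zs (r k) \<omega>)) \<longlonglongrightarrow> (if \<omega> \<in> A then X \<omega> else Y \<omega>)"
      if "X \<omega> = ereal x" "Y \<omega> = ereal y" "(\<lambda>k. Xs (r k) \<omega>) \<longlonglongrightarrow> x" "(\<lambda>k. Ys (r k) \<omega>) \<longlonglongrightarrow> y"
      for \<omega> r x y
      using that by (auto simp: Zs_def indicator_def)
  qed (simp add: qs_I)
  then show ?thesis by (auto simp: L1_def)
qed

text \<open>Functions live on the whole ambient type, whereas bounds on \<open>T\<close> hold only
  on \<Omega>; this bridges the two.\<close>

lemma L1_cong:
  assumes "X \<in> L1 \<Omega> F H E" "\<And>\<omega>. \<omega> \<in> \<Omega> \<Longrightarrow> X \<omega> = Y \<omega>"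
  shows "Y \<in> L1 \<Omega> F H E"
proof -
  obtain Xs where X: "conv Xs X" using assms by (auto simp: L1_def)
  have "Y \<in> borel_measurable G \<longleftrightarrow> X \<in> borel_measurable G"
    by (intro measurable_cong) (simp add: assms)
  moreover obtain r where r: "strict_mono r" "qs (\<lambda>\<omega>. (\<lambda>k. ereal (Xs (r k) \<omega>)) \<longlonglongrightarrow> X \<omega>)"
    using X by (auto simp: conv_iff)
  moreover have "qs (\<lambda>\<omega>. (\<lambda>k. ereal (Xs (r k) \<omega>)) \<longlonglongrightarrow> Y \<omega>)"
    by (rule qs_mono[OF r(2)]) (simp add: assms(2))
  ultimately have "conv Xs Y"
    using X unfolding conv_iff by blast
  then show ?thesis by (auto simp: L1_def)
qed

text \<open>Induction on a cap \<open>k\<close> for the stopping time: raising it to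
  \<open>Suc k\<close> keeps the value on \<open>{T \<le> k}\<close> and inserts
  \<open>X (Suc k)\<close> elsewhere. At \<open>k = n\<close> the cap has no effect on
  \<Omega>.\<close>

lemma at_time_L1:
  assumes X: "\<And>t. X t \<in> L1 \<Omega> F H E" and T: "stopping_time F T" and n: "\<forall>\<omega>\<in>\<Omega>. T \<omega> \<le> n"
  shows "at_time X T \<in> L1 \<Omega> F H E"
proof -
  have "at_time X (\<lambda>\<omega>. min (T \<omega>) k) \<in> L1 \<Omega> F H E" for k
  proof (induction k)
    case 0
    then show ?case by (rule L1_cong[OF X[of 0]]) (simp add: at_time_def)
  next
    case (Suc k)
    have "{\<omega> \<in> \<Omega>. T \<omega> \<le> k} \<in> sets G" using stopping_set[OF T] sets_F_subset_G by blast
    from L1_if[OF Suc X[of "Suc k"] this] show ?case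
      by (rule L1_cong) (auto simp: at_time_def min_def le_Suc_eq)
  qed
  then show ?thesis
    by (rule L1_cong) (use n in \<open>auto simp: at_time_def min_def\<close>)
qed

section \<open>Backward induction for the stopped submartingale\<close>

text \<open>A fixed time \<open>s\<close> in place of \<open>S\<close> makes the induction possible.
  The restriction to \<open>s \<le> T \<omega>\<close> matters because after \<open>T\<close> the
  claim would compare \<open>X s\<close> with an earlier value.\<close>

lemma submartingale_le_ext_at_time:
  assumes sub: "SL_submartingale \<Omega> F H E X"
    and T: "stopping_time F T" and n: "\<forall>\<omega>\<in>\<Omega>. T \<omega> \<le> n"
  shows "qs (\<lambda>\<omega>. s \<le> T \<omega> \<longrightarrow> X s \<omega> \<le> ext s (at_time X T) \<omega>)"
proof -
  have XL: "X t \<in> L1 \<Omega> F H E" for t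
    using sub by (auto simp: SL_submartingale_def)
  have X_le: "qs (\<lambda>\<omega>. X s \<omega> \<le> ext s (X t) \<omega>)" if "s \<le> t" for s t
    using sub that by (auto simp: SL_submartingale_def)
  have "\<exists>Xs. \<forall>t. conv (Xs t) (X t)" using XL by (intro choice) (auto simp: L1_def)
  then obtain Xs where Xs: "\<And>t. conv (Xs t) (X t)" by auto
  obtain Zs where Z: "conv Zs (at_time X T)"
    using at_time_L1[of X, OF XL T n] unfolding L1_def by blast
  show ?thesis
  \<comment> \<open>The induction starts at \<open>Suc n\<close>, one step beyond the bound on
    \<open>T\<close>, where no point satisfies \<open>s \<le> T \<omega>\<close>; larger
    \<open>s\<close> are vacuous for the same reason.\<close>
  proof (cases "s \<le> Suc n")
    case True
    then show ?thesis
    proof (induction s rule: inc_induct)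
      case base
      show ?case by (rule qs_I) (use n in force)
    next
      case (step s)
      define A where "A = {\<omega> \<in> \<Omega>. T \<omega> = s}"
      define B where "B = {\<omega> \<in> \<Omega>. Suc s \<le> T \<omega>}"
      have le_s: "{\<omega> \<in> \<Omega>. T \<omega> \<le> s} \<in> sets (F s)" by (rule stopping_set[OF T])
      have "B = space (F s) - {\<omega> \<in> \<Omega>. T \<omega> \<le> s}" by (auto simp: B_def space_F)
      then have B: "B \<in> sets (F s)" using le_s by auto
      have A: "A \<in> sets (F s)"
      \<comment> \<open>At time 0 there is no predecessor, and \<open>{T = 0}\<close> is
        \<open>{T \<le> 0}\<close>; otherwise \<open>{T = s}\<close> is a difference of two sublevel
        sets.\<close>
      proof (cases s)
        case 0
        then show ?thesis using le_s by (simp add: A_def)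
      next
        case (Suc s')
        have "{\<omega> \<in> \<Omega>. T \<omega> \<le> s'} \<in> sets (F s)"
          using stopping_set[OF T, of s'] sets_F_mono[of s' s] Suc by auto
        moreover have "A = {\<omega> \<in> \<Omega>. T \<omega> \<le> s} - {\<omega> \<in> \<Omega>. T \<omega> \<le> s'}"
          using Suc by (auto simp: A_def)
        ultimately show ?thesis using le_s by auto
      qed
      have onA: "qs (\<lambda>\<omega>. \<omega> \<in> A \<longrightarrow> ext s (X s) \<omega> \<le> ext s (at_time X T) \<omega>)"
        by (intro ext_mono_on[OF Xs Z A] qs_I) (simp add: A_def at_time_def)
      have "qs (\<lambda>\<omega>. \<omega> \<in> B \<longrightarrow> X (Suc s) \<omega> \<le> ext (Suc s) (at_time X T) \<omega>)"
        by (rule qs_mono[OF step.IH]) (simp add: B_def)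
      \<comment> \<open>\<open>conv_ext\<close> exhibits an approximating sequence for the extended
        expectation at time \<open>Suc s\<close>, so the time-\<open>s\<close> expectation can be
        applied to both sides on \<open>B\<close>.\<close>
      from ext_mono_on[OF Xs conv_ext[OF Z] B this]
      have "qs (\<lambda>\<omega>. \<omega> \<in> B \<longrightarrow> ext s (X (Suc s)) \<omega> \<le> ext s (ext (Suc s) (at_time X T)) \<omega>)" .
      from qs_mono3[OF this ext_tower_le[OF Z, of s "Suc s"] X_le[of s "Suc s"],
          where S = "\<lambda>\<omega>. \<omega> \<in> B \<longrightarrow> X s \<omega> \<le> ext s (at_time X T) \<omega>"]
      have onB: "qs (\<lambda>\<omega>. \<omega> \<in> B \<longrightarrow> X s \<omega> \<le> ext s (at_time X T) \<omega>)"
        by (auto intro: order_trans)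
      \<comment> \<open>On \<open>A\<close>, the submartingale property at equal times supplies the
        link from \<open>X s\<close> to \<open>ext s (X s)\<close>.\<close>
      show ?case
      proof (rule qs_mono3[OF onA onB X_le[of s s]], rule order_refl, rule impI)
        fix \<omega> assume *: "\<omega> \<in> \<Omega>" "\<omega> \<in> A \<longrightarrow> ext s (X s) \<omega> \<le> ext s (at_time X T) \<omega>"
          "\<omega> \<in> B \<longrightarrow> X s \<omega> \<le> ext s (at_time X T) \<omega>" "X s \<omega> \<le> ext s (X s) \<omega>" "s \<le> T \<omega>"
        then have "\<omega> \<in> A \<or> \<omega> \<in> B" by (auto simp: A_def B_def)
        then show "X s \<omega> \<le> ext s (at_time X T) \<omega>" using * by (auto intro: order_trans)
      qed
    qed
  next
    case False
    then show ?thesis by (intro qs_I) (use n in force)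
  qed
qed

end

theorem theorem4p1:
  fixes \<Omega> :: "'a set"
    and F :: "nat \<Rightarrow> 'a measure"
    and H :: "('a \<Rightarrow> real) set"
    and E :: "nat \<Rightarrow> ('a \<Rightarrow> real) \<Rightarrow> ('a \<Rightarrow> real)"
    and X :: "nat \<Rightarrow> 'a \<Rightarrow> ereal"
    and S T :: "'a \<Rightarrow> nat"
  assumes "SL_expectation \<Omega> F H E"
    and "SL_submartingale \<Omega> F H E X"
    and "stopping_time F S" and "stopping_time F T"
    and "\<exists>n. \<forall>\<omega>\<in>\<Omega>. S \<omega> \<le> n" and "\<exists>n. \<forall>\<omega>\<in>\<Omega>. T \<omega> \<le> n"
    and "\<forall>\<omega>\<in>\<Omega>. S \<omega> \<le> T \<omega>"
  shows "quasi_surely \<Omega> F E (\<lambda>\<omega>. at_time X S \<omega> \<le> E_stop \<Omega> F H E S (at_time X T) \<omega>)"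
proof -
  interpret SL_expectation \<Omega> F H E by fact
  obtain n where n: "\<forall>\<omega>\<in>\<Omega>. T \<omega> \<le> n" using assms(6) by blast
  \<comment> \<open>As there are countably many \<open>s\<close>, one exceptional set serves them
    all; off it, \<open>s\<close> may be replaced by the \<omega>-dependent value
    \<open>S \<omega>\<close>.\<close>
  have "qs (\<lambda>\<omega>. \<forall>s. s \<le> T \<omega> \<longrightarrow> X s \<omega> \<le> ext s (at_time X T) \<omega>)"
    by (intro qs_all submartingale_le_ext_at_time[OF assms(2,4) n])
  then show ?thesis
    by (rule qs_mono) (use assms(7) in \<open>simp add: at_time_def[of X S] E_stop_def\<close>)
qed

end
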